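(* Let $(T(t))_{t\ge 0}$ be a uniformly bounded $C_0$-semigroup on a Hilbert space $H$ with generator $A$ such that $i\mathbb{R}\subset\varrho(A)$. Suppose that the Cayley transform $A_d := (I+A)(I-A)^{-1}$ is power bounded, i.e. $\sup_{n\ge 0}\|A_d^n\|<\infty$. If $\|T(t)(-A)^{-\alpha}\| = O(1/t)$ as $t\to\infty$ for some $\alpha>0$, then $$\|A_d^n(-A)^{-\alpha-2}x\| = o\left(\frac{\log n}{n}\right)\qquad (n\to\infty)$$ for every $x\in H$, and $$\|A_d^n(-A)^{-\alpha-2}\| = O\left(\frac{\log n}{n}\right)\qquad (n\to\infty).$$
   Context: All spaces are complex. $\varrho(A)$ is the resolvent set of $A$ and $i\mathbb{R}=\{i\eta:\eta\in\mathbb{R}\}$. A $C_0$-semigroup is uniformly bounded if $\sup_{t\ge0}\|T(t)\|<\infty$. For real-valued functions, $f(t)=O(g(t))$ as $t\to\infty$ means there are $M>0$ and $t_0$ with $f(t)\le M g(t)$ for all $t\ge t_0$; $f(t)=o(g(t))$ means that for every $\varepsilon>0$ there is $t_0$ with $f(t)\le \varepsilon g(t)$ for all $t\ge t_0$ (similarly for sequences). When $A$ generates a uniformly bounded $C_0$-semigroup and $0\in\varrho(A)$, $-A$ is sectorial and invertible, and the fractional powers $(-A)^{a}$, $a\in\mathbb{R}$, are those of the functional calculus for sectorial operators. In particular, for $a>0$, $(-A)^{-a}$ is the bounded injective operator determined by $(-A)^{-a}=\frac{\sin \pi a}{\pi}\int_0^\infty s^{-a}(sI-A)^{-1}ds$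 for $0<a<1$ and $(-A)^{-(k+a)}=((-A)^{-1})^k(-A)^{-a}$ for $k\in\mathbb{N}$, $0\le a<1$ (with $(-A)^0=I$), and $(-A)^{a}$ is its inverse. *)

theory Defs
  imports "HOL-Analysis.Analysis" "HOL-Library.Landau_Symbols"
begin

section \<open>Complex Hilbert spaces\<close>

class complex_vector = real_vector +
  fixes scaleC :: "complex \<Rightarrow> 'a \<Rightarrow> 'a" (infixr \<open>*\<^sub>C\<close> 75)
  assumes scaleC_add_right: "c *\<^sub>C (x + y) = c *\<^sub>C x + c *\<^sub>C y"
    and scaleC_add_left: "(c + d) *\<^sub>C x = c *\<^sub>C x + d *\<^sub>C x"
    and scaleC_scaleC: "c *\<^sub>C d *\<^sub>C x = (c * d) *\<^sub>C x"
    and scaleC_of_real: "complex_of_real r *\<^sub>C x = r *\<^sub>R x"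

class complex_normed_vector = complex_vector + real_normed_vector +
  assumes norm_scaleC: "norm (c *\<^sub>C x) = cmod c * norm x"

text \<open>
  The complex inner product is linear in its first argument. Positive definiteness and
  the identity between the norm of \<open>x\<close> and the square root of \<open>cinner x x\<close> are inherited
  from the class \<^class>\<open>real_inner\<close>, whose inner product is required to be the real part of
  the complex one.
\<close>

class complex_inner = complex_vector + real_inner +
  fixes cinner :: "'a \<Rightarrow> 'a \<Rightarrow> complex"
  assumes cinner_commute: "cinner x y = cnj (cinner y x)"
    and cinner_add_left: "cinner (x + y) z = cinner x z + cinner y z"
    and cinner_scaleC_left: "cinner (c *\<^sub>C x) y = c * cinner x y"
    and inner_eq_Re_cinner: "inner x y = Re (cinner x y)"
begin

lemma cinner_self: "cinner x x = complex_of_real ((norm x)\<^sup>2)"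
proof (rule complex_eqI)
  show "Re (cinner x x) = Re (complex_of_real ((norm x)\<^sup>2))"
    by (simp add: norm_eq_sqrt_inner flip: inner_eq_Re_cinner)
  have "Im (cinner x x) = - Im (cinner x x)"
    by (subst cinner_commute) simp
  then show "Im (cinner x x) = Im (complex_of_real ((norm x)\<^sup>2))"
    by simp
qed

subclass complex_normed_vector
proof
  fix c x
  have "cinner (c *\<^sub>C x) (c *\<^sub>C x) = c * cnj c * cinner x x"
    using cinner_commute[of x "c *\<^sub>C x"] cinner_commute[of x x]
    by (simp add: cinner_scaleC_left)
  then have "complex_of_real ((norm (c *\<^sub>C x))\<^sup>2) = complex_of_real ((cmod c * norm x)\<^sup>2)"
    by (simp add: cinner_self power_mult_distrib flip: complex_norm_square)
  then have "(norm (c *\<^sub>C x))\<^sup>2 = (cmod c * norm x)\<^sup>2"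
    by (simp only: of_real_eq_iff)
  then show "norm (c *\<^sub>C x) = cmod c * norm x"
    by (rule power2_eq_imp_eq) simp_all
qed

end

class chilbert_space = complex_inner + complete_space
begin

subclass banach ..

end

instantiation complex :: chilbert_space
begin

definition scaleC_complex :: "complex \<Rightarrow> complex \<Rightarrow> complex" where
  "scaleC_complex c x = c * x"

definition cinner_complex :: "complex \<Rightarrow> complex \<Rightarrow> complex" where
  "cinner_complex x y = x * cnj y"

instance
  by standard
    (auto simp: scaleC_complex_def cinner_complex_def algebra_simps scaleR_conv_of_real inner_complex_def)

end


section \<open>Unbounded operators, semigroups and their generators\<close>

definition bounded_clinear ::
    "('a::complex_normed_vector \<Rightarrow> 'b::complex_normed_vector) \<Rightarrow> bool" where
  "bounded_clinear f \<longleftrightarrow> bounded_linear f \<and> (\<forall>c x. f (c *\<^sub>C x) = c *\<^sub>C f x)"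

text \<open>
  An unbounded operator is given by its domain \<open>D\<close> and a function \<open>A\<close>. The values of \<open>A\<close>
  outside \<open>D\<close> play no role: every definition below evaluates \<open>A\<close> only on \<open>D\<close>
  (\<open>inv_into D\<close> takes its values in \<open>D\<close>).
\<close>

definition resolvent ::
    "'a::complex_normed_vector set \<Rightarrow> ('a \<Rightarrow> 'a) \<Rightarrow> complex \<Rightarrow> 'a \<Rightarrow> 'a" where
  "resolvent D A l = inv_into D (\<lambda>x. l *\<^sub>C x - A x)"

definition resolvent_set ::
    "'a::complex_normed_vector set \<Rightarrow> ('a \<Rightarrow> 'a) \<Rightarrow> complex set" where
  "resolvent_set D A =
     {l. bij_betw (\<lambda>x. l *\<^sub>C x - A x) D UNIV \<and> bounded_clinear (resolvent D A l)}"

text \<open>Semigroups are indexed by real numbers; only the operators \<open>T t\<close> with \<open>t \<ge> 0\<close> matter.\<close>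

definition C0_semigroup :: "(real \<Rightarrow> 'a::complex_normed_vector \<Rightarrow> 'a) \<Rightarrow> bool" where
  "C0_semigroup T \<longleftrightarrow>
     (\<forall>t\<ge>0. bounded_clinear (T t)) \<and>
     T 0 = id \<and>
     (\<forall>s\<ge>0. \<forall>t\<ge>0. T (s + t) = T s \<circ> T t) \<and>
     (\<forall>x. ((\<lambda>t. T t x) \<longlongrightarrow> x) (at_right 0))"

definition uniformly_bounded_semigroup :: "(real \<Rightarrow> 'a::complex_normed_vector \<Rightarrow> 'a) \<Rightarrow> bool" where
  "uniformly_bounded_semigroup T \<longleftrightarrow> bdd_above ((\<lambda>t. onorm (T t)) ` {0..})"

definition is_generator ::
    "(real \<Rightarrow> 'a::complex_normed_vector \<Rightarrow> 'a) \<Rightarrow> 'a set \<Rightarrow> ('a \<Rightarrow> 'a) \<Rightarrow> bool" where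
  "is_generator T D A \<longleftrightarrow>
     D = {x. \<exists>y. ((\<lambda>t. (T t x - x) /\<^sub>R t) \<longlongrightarrow> y) (at_right 0)} \<and>
     (\<forall>x\<in>D. ((\<lambda>t. (T t x - x) /\<^sub>R t) \<longlongrightarrow> A x) (at_right 0))"


section \<open>Cayley transform and fractional powers\<close>

text \<open>\<open>(I + A) (I - A)\<^sup>-\<^sup>1\<close>\<close>

definition cayley :: "'a::complex_normed_vector set \<Rightarrow> ('a \<Rightarrow> 'a) \<Rightarrow> 'a \<Rightarrow> 'a" where
  "cayley D A = (\<lambda>y. y + A y) \<circ> resolvent D A 1"

definition power_bounded :: "('a::complex_normed_vector \<Rightarrow> 'a) \<Rightarrow> bool" where
  "power_bounded S \<longleftrightarrow> bounded_clinear S \<and> bdd_above (range (\<lambda>n::nat. onorm (S ^^ n)))"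

text \<open>
  \<open>(- A)\<^sup>-\<^sup>a\<close> for \<open>0 \<le> a < 1\<close>. The integral of the operator-valued function is taken pointwise
  (strongly). The integral is the Henstock-Kurzweil one, since the Bochner integral of the
  library is restricted to separable spaces; for generators of bounded semigroups with \<open>0\<close> in
  the resolvent set the integrand is continuous and absolutely integrable.
\<close>

definition neg_frac_power_inv_aux ::
    "'a::{complex_normed_vector, banach} set \<Rightarrow> ('a \<Rightarrow> 'a) \<Rightarrow> real \<Rightarrow> 'a \<Rightarrow> 'a" where
  "neg_frac_power_inv_aux D A a x =
     (if a = 0 then x
      else (sin (pi * a) / pi) *\<^sub>R
        integral {0<..} (\<lambda>s. s powr (- a) *\<^sub>R resolvent D A (complex_of_real s) x))"

text \<open>
  \<open>(- A)\<^sup>-\<^sup>b\<close> for \<open>b \<ge> 0\<close>, with \<open>b\<close> split into its integer and fractional parts; note that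
  \<open>resolvent D A 0\<close> is \<open>(- A)\<^sup>-\<^sup>1\<close>.
\<close>

definition neg_frac_power_inv ::
    "'a::{complex_normed_vector, banach} set \<Rightarrow> ('a \<Rightarrow> 'a) \<Rightarrow> real \<Rightarrow> 'a \<Rightarrow> 'a" where
  "neg_frac_power_inv D A b =
     (resolvent D A 0 ^^ nat \<lfloor>b\<rfloor>) \<circ> neg_frac_power_inv_aux D A (frac b)"

end

theory Submission
  imports Defs
begin

text \<open>
  Write \<open>P = (- A)\<^sup>-\<^sup>\<alpha>\<close>, \<open>R = (I - A)\<^sup>-\<^sup>1\<close>, \<open>V = 2 R - I\<close> for the Cayley transform and
  \<open>x\<^sub>k = V\<^sup>k x\<close>. Since \<open>x = y - A y\<close> and \<open>V x = y + A y\<close> with \<open>y = R x\<close>, polarization and partial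
  integration give, for every weight \<open>w\<close> on \<open>[0, n]\<close>, a Lyapunov identity: the energy
  \<open>\<integral> w(t) \<parallel>P T(t) x\<parallel>\<^sup>2 dt\<close> drops under \<open>x \<mapsto> V x\<close> by \<open>2 \<integral> w'(t) \<parallel>P T(t) R x\<parallel>\<^sup>2 dt\<close>, up to boundary
  terms. Because \<open>\<parallel>P T(t)\<parallel> = O(1/t)\<close>, the energy with weight \<open>t\<close> is \<open>O(log n)\<close>, so the unweighted
  energies of \<open>R x\<^sub>k\<close>, \<open>k < n\<close>, have sum \<open>O(log n)\<close>. Applying the identity with weight \<open>1\<close> to them
  and summing by parts, \<open>\<Sum>k (k + 1) \<parallel>P R\<^sup>2 x\<^sub>k\<parallel>\<^sup>2 = O(log n)\<close>. Power boundedness then yields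
  \<open>n\<^sup>2 \<parallel>P R\<^sup>2 x\<^sub>n\<parallel>\<^sup>2 = O(log n)\<close>, that is, the rate \<open>sqrt (log n) / n\<close>, which is better than both
  claims. Replacing \<open>R\<^sup>2\<close> by \<open>(- A)\<^sup>-\<^sup>2\<close> costs only the bounded factor \<open>(I + (- A)\<^sup>-\<^sup>1)\<^sup>2\<close>.
\<close>


section \<open>Resolvents and fractional powers\<close>

lemma bounded_clinear_imp_linear: "bounded_clinear f \<Longrightarrow> bounded_linear f"
  by (simp add: bounded_clinear_def)

lemma bounded_linear_funpow: "bounded_linear f \<Longrightarrow> bounded_linear (f ^^ n)"
  for f :: "'a::real_normed_vector \<Rightarrow> 'a"
  by (induction n) (auto simp: id_def o_def intro: bounded_linear_compose)

lemma funpow_commute_with: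
  assumes "\<And>x. S (f x) = f (S x)"
  shows "S ((f ^^ n) x) = (f ^^ n) (S x)"
  by (induction n arbitrary: x) (simp_all add: assms)

text \<open>Composing with this map turns a limit at \<open>0\<close> from the right into a
  two-sided limit at \<open>t\<close>.\<close>

lemma filterlim_abs_diff_at_right:
  fixes t :: real
  shows "filterlim (\<lambda>s. \<bar>s - t\<bar>) (at_right 0) (at t within S)"
  unfolding filterlim_at
proof
  show "\<forall>\<^sub>F s in at t within S. \<bar>s - t\<bar> \<in> {0<..} \<and> \<bar>s - t\<bar> \<noteq> 0"
    by (auto simp: eventually_at intro!: exI[of _ 1])
  have "((\<lambda>s. \<bar>s - t\<bar>) \<longlongrightarrow> \<bar>t - t\<bar>) (at t within S)"
    by (intro tendsto_intros)
  then show "((\<lambda>s. \<bar>s - t\<bar>) \<longlongrightarrow> 0) (at t within S)" by simp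
qed

text \<open>Links the remainder in \<open>has_derivative_iff_norm\<close> to the difference quotient
  that defines the generator.\<close>

lemma norm_difference_quotient:
  fixes u v :: "'a::real_normed_vector"
  assumes "c \<noteq> 0"
  shows "norm (u - c *\<^sub>R v) / norm c = norm (u /\<^sub>R c - v)"
proof -
  have "u /\<^sub>R c - v = (u - c *\<^sub>R v) /\<^sub>R c"
    using assms by (simp add: scaleR_diff_right)
  then have "norm (u /\<^sub>R c - v) = norm ((u - c *\<^sub>R v) /\<^sub>R c)" by (rule arg_cong)
  then show ?thesis by (simp add: divide_inverse mult.commute)
qed

lemma divideR_minus_diff: "(u - w) /\<^sub>R c = (w - u) /\<^sub>R (- c)" for u w :: "'a::real_vector"
  by (simp add: scaleR_diff_right)

section \<open>Continuity and differentiability of the orbits\<close>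

locale bounded_semigroup_generator =
  fixes T :: "real \<Rightarrow> 'h::chilbert_space \<Rightarrow> 'h" and D :: "'h set" and A :: "'h \<Rightarrow> 'h" and M :: real
  assumes C0: "C0_semigroup T"
    and M_pos: "M > 0"
    and norm_T_le: "t \<ge> 0 \<Longrightarrow> norm (T t x) \<le> M * norm x"
    and gen: "is_generator T D A"
    and zero_resolvent: "0 \<in> resolvent_set D A"
begin

lemma T_linear: "t \<ge> 0 \<Longrightarrow> bounded_linear (T t)"
  using C0 unfolding C0_semigroup_def by (blast intro: bounded_clinear_imp_linear)

lemmas T_diff = linear_diff[OF bounded_linear.linear[OF T_linear]]
  and T_add = linear_add[OF bounded_linear.linear[OF T_linear]]
  and T_scaleR = linear_scale[OF bounded_linear.linear[OF T_linear]]

lemma T_zero [simp]: "T 0 x = x"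
  using C0 by (simp add: C0_semigroup_def)

lemma T_plus: "s \<ge> 0 \<Longrightarrow> t \<ge> 0 \<Longrightarrow> T (s + t) x = T s (T t x)"
  using C0 by (simp add: C0_semigroup_def)

lemma T_commute: "s \<ge> 0 \<Longrightarrow> t \<ge> 0 \<Longrightarrow> T s (T t x) = T t (T s x)"
  by (metis T_plus add.commute)

lemma T_tendsto: "((\<lambda>t. T t x) \<longlongrightarrow> x) (at_right 0)"
  using C0 by (simp add: C0_semigroup_def)

text \<open>Factoring out \<open>T\<close> at the smaller time leaves an increment that starts at
  time \<open>0\<close>. The uniform bound then turns right continuity at \<open>0\<close> into
  two-sided continuity.\<close>

lemma norm_T_diff_le:
  assumes "s \<ge> 0" "t \<ge> 0"
  shows "norm (T s x - T t x) \<le> M * norm (T \<bar>s - t\<bar> x - x)"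
proof (cases "s \<le> t")
  case True
  then have "T s x - T t x = T s (x - T (t - s) x)"
    using T_plus[of s "t - s" x] assms by (simp add: T_diff)
  then show ?thesis
    using norm_T_le[of s "x - T (t - s) x"] assms True by (simp add: norm_minus_commute)
next
  case False
  then have "T s x - T t x = T t (T (s - t) x - x)"
    using T_plus[of t "s - t" x] assms by (simp add: T_diff)
  then show ?thesis
    using norm_T_le[of t "T (s - t) x - x"] assms False by simp
qed

lemma T_tendsto_within:
  assumes "t \<ge> 0"
  shows "((\<lambda>s. T s x) \<longlongrightarrow> T t x) (at t within {0..})"
proof -
  have "((\<lambda>s. M * norm (T \<bar>s - t\<bar> x - x)) \<longlongrightarrow> M * norm (x - x)) (at t within {0..})"
    by (intro tendsto_intros filterlim_compose[OF T_tendsto] filterlim_abs_diff_at_right)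
  then have lim: "((\<lambda>s. M * norm (T \<bar>s - t\<bar> x - x)) \<longlongrightarrow> 0) (at t within {0..})"
    by simp
  have "((\<lambda>s. T s x - T t x) \<longlongrightarrow> 0) (at t within {0..})"
  proof (rule Lim_null_comparison[OF _ lim])
    show "\<forall>\<^sub>F s in at t within {0..}. norm (T s x - T t x) \<le> M * norm (T \<bar>s - t\<bar> x - x)"
      unfolding eventually_at_filter
      by (intro always_eventually allI impI norm_T_diff_le assms) simp
  qed
  then show ?thesis by (rule LIM_zero_cancel)
qed

lemma continuous_on_T: "continuous_on {0..} (\<lambda>t. T t x)"
  unfolding continuous_on_def by (blast intro: T_tendsto_within)

lemma D_quotient: "x \<in> D \<Longrightarrow> ((\<lambda>h. (T h x - x) /\<^sub>R h) \<longlongrightarrow> A x) (at_right 0)"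
  using gen by (simp add: is_generator_def)

lemma D_I:
  assumes "((\<lambda>h. (T h x - x) /\<^sub>R h) \<longlongrightarrow> y) (at_right 0)"
  shows "x \<in> D" and "A x = y"
proof -
  have "D = {x. \<exists>y. ((\<lambda>h. (T h x - x) /\<^sub>R h) \<longlongrightarrow> y) (at_right 0)}"
    using gen by (simp only: is_generator_def)
  then show "x \<in> D" using assms by auto
  then show "A x = y" using tendsto_unique[OF _ D_quotient assms] by simp
qed

lemma D_comb:
  assumes "x \<in> D" "y \<in> D"
  shows "a *\<^sub>R x + b *\<^sub>R y \<in> D" and "A (a *\<^sub>R x + b *\<^sub>R y) = a *\<^sub>R A x + b *\<^sub>R A y"
proof -
  have "((\<lambda>h. a *\<^sub>R ((T h x - x) /\<^sub>R h) + b *\<^sub>R ((T h y - y) /\<^sub>R h)) \<longlongrightarrow> a *\<^sub>R A x + b *\<^sub>R A y) (at_right 0)"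
    by (intro tendsto_intros D_quotient assms)
  moreover have "\<forall>\<^sub>F h in at_right 0. a *\<^sub>R ((T h x - x) /\<^sub>R h) + b *\<^sub>R ((T h y - y) /\<^sub>R h) =
      (T h (a *\<^sub>R x + b *\<^sub>R y) - (a *\<^sub>R x + b *\<^sub>R y)) /\<^sub>R h"
    unfolding eventually_at_right_field
  proof (intro exI[of _ 1] conjI allI impI)
    fix h :: real assume "0 < h"
    then have "T h (a *\<^sub>R x + b *\<^sub>R y) = a *\<^sub>R T h x + b *\<^sub>R T h y"
      by (simp only: T_add T_scaleR less_imp_le)
    then show "a *\<^sub>R ((T h x - x) /\<^sub>R h) + b *\<^sub>R ((T h y - y) /\<^sub>R h) =
      (T h (a *\<^sub>R x + b *\<^sub>R y) - (a *\<^sub>R x + b *\<^sub>R y)) /\<^sub>R h"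
      by (simp only:) (simp add: algebra_simps)
  qed simp
  ultimately have "((\<lambda>h. (T h (a *\<^sub>R x + b *\<^sub>R y) - (a *\<^sub>R x + b *\<^sub>R y)) /\<^sub>R h)
      \<longlongrightarrow> a *\<^sub>R A x + b *\<^sub>R A y) (at_right 0)"
    by (rule Lim_transform_eventually)
  then show "a *\<^sub>R x + b *\<^sub>R y \<in> D" "A (a *\<^sub>R x + b *\<^sub>R y) = a *\<^sub>R A x + b *\<^sub>R A y"
    by (rule D_I)+
qed

lemma T_D:
  assumes "x \<in> D" "t \<ge> 0"
  shows "T t x \<in> D" and "A (T t x) = T t (A x)"
proof -
  have "((\<lambda>h. T t ((T h x - x) /\<^sub>R h)) \<longlongrightarrow> T t (A x)) (at_right 0)"
    by (intro bounded_linear.tendsto[OF T_linear] D_quotient assms)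
  moreover have "\<forall>\<^sub>F h in at_right 0. T t ((T h x - x) /\<^sub>R h) = (T h (T t x) - T t x) /\<^sub>R h"
    unfolding eventually_at_right_field
  proof (intro exI[of _ 1] conjI allI impI)
    fix h :: real assume "0 < h"
    then show "T t ((T h x - x) /\<^sub>R h) = (T h (T t x) - T t x) /\<^sub>R h"
      using T_commute[of h t x] assms(2) by (simp only: T_diff T_scaleR less_imp_le)
  qed simp
  ultimately have "((\<lambda>h. (T h (T t x) - T t x) /\<^sub>R h) \<longlongrightarrow> T t (A x)) (at_right 0)"
    by (rule Lim_transform_eventually)
  then show "T t x \<in> D" "A (T t x) = T t (A x)" by (rule D_I)+
qed

text \<open>The generator only provides right derivatives at \<open>0\<close>; the fundamental
  theorem of calculus, used for the energies, asks for two-sided ones inside the interval.\<close>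

lemma T_has_vector_derivative:
  assumes x: "x \<in> D" and t: "t \<ge> 0"
  shows "((\<lambda>t. T t x) has_vector_derivative T t (A x)) (at t within {0..})"
proof -
  let ?q = "\<lambda>h. (T h x - x) /\<^sub>R h"
  have q: "((\<lambda>s. ?q \<bar>s - t\<bar>) \<longlongrightarrow> A x) (at t within {0..})"
    by (rule filterlim_compose[OF D_quotient[OF x] filterlim_abs_diff_at_right])
  have lim: "((\<lambda>s. M * norm (?q \<bar>s - t\<bar> - A x) + norm (T s (A x) - T t (A x)))
      \<longlongrightarrow> M * norm (A x - A x) + norm (T t (A x) - T t (A x))) (at t within {0..})"
    by (intro tendsto_intros q T_tendsto_within t)
  \<comment> \<open>From the left the factor that comes out is \<open>T s\<close> instead of
    \<open>T t\<close>. The second summand pays for this and vanishes in the limit by strong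
    continuity; from the right it is mere slack.\<close>
  have key: "norm ((T s x - T t x) /\<^sub>R (s - t) - T t (A x))
      \<le> M * norm (?q \<bar>s - t\<bar> - A x) + norm (T s (A x) - T t (A x))" if s: "s \<ge> 0" "s \<noteq> t" for s
  proof (cases "s \<le> t")
    case True
    have "T t x = T s (T (t - s) x)" using T_plus[of s "t - s" x] s True by simp
    then have "T s (?q (t - s)) = (T t x - T s x) /\<^sub>R (t - s)"
      using s by (simp only: T_diff T_scaleR)
    then have "(T s x - T t x) /\<^sub>R (s - t) = T s (?q (t - s))"
      using divideR_minus_diff[where c = "s - t" and u = "T s x" and w = "T t x"] by (simp only: minus_diff_eq)
    then have "(T s x - T t x) /\<^sub>R (s - t) - T t (A x) =
       T s (?q (t - s) - A x) + (T s (A x) - T t (A x))"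
      using s by (simp only: T_diff) simp
    then have "norm ((T s x - T t x) /\<^sub>R (s - t) - T t (A x)) =
       norm (T s (?q (t - s) - A x) + (T s (A x) - T t (A x)))"
      by (rule arg_cong)
    then show ?thesis
      using norm_triangle_ineq[of "T s (?q (t - s) - A x)" "T s (A x) - T t (A x)"]
        norm_T_le[OF s(1), of "?q (t - s) - A x"] True
      by (simp only: abs_of_nonpos diff_le_0_iff_le minus_diff_eq)
  next
    case False
    then have "T s x = T t (T (s - t) x)" using T_plus[of t "s - t" x] t by simp
    then have "T t (?q (s - t)) = (T s x - T t x) /\<^sub>R (s - t)"
      using t by (simp only: T_diff T_scaleR)
    then have "(T s x - T t x) /\<^sub>R (s - t) - T t (A x) = T t (?q (s - t) - A x)"
      using t by (simp only: T_diff)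
    then show ?thesis
      using norm_T_le[OF t, of "?q (s - t) - A x"] False norm_ge_zero[of "T s (A x) - T t (A x)"]
      by (simp only: abs_of_nonneg diff_ge_0_iff_ge not_le less_imp_le)
  qed
  have quotient: "norm ((T s x - T t x) - (s - t) *\<^sub>R T t (A x)) / norm (s - t) =
      norm ((T s x - T t x) /\<^sub>R (s - t) - T t (A x))" if "s \<noteq> t" for s
    by (rule norm_difference_quotient) (use that in simp)
  have "((\<lambda>s. norm ((T s x - T t x) - (s - t) *\<^sub>R T t (A x)) / norm (s - t)) \<longlongrightarrow> 0)
      (at t within {0..})"
  proof (rule Lim_null_comparison)
    show "\<forall>\<^sub>F s in at t within {0..}. norm (norm ((T s x - T t x) - (s - t) *\<^sub>R T t (A x)) / norm (s - t))
        \<le> M * norm (?q \<bar>s - t\<bar> - A x) + norm (T s (A x) - T t (A x))"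
      unfolding eventually_at_filter
    proof (intro always_eventually allI impI)
      fix s assume s: "s \<noteq> t" "s \<in> {0..}"
      have "norm (norm ((T s x - T t x) - (s - t) *\<^sub>R T t (A x)) / norm (s - t)) =
          norm (norm ((T s x - T t x) /\<^sub>R (s - t) - T t (A x)))"
        by (simp only: quotient[OF s(1)])
      also have "\<dots> = norm ((T s x - T t x) /\<^sub>R (s - t) - T t (A x))"
        by (simp only: real_norm_def abs_norm_cancel)
      also have "\<dots> \<le> M * norm (?q \<bar>s - t\<bar> - A x) + norm (T s (A x) - T t (A x))"
        by (rule key) (use s in auto)
      finally show "norm (norm ((T s x - T t x) - (s - t) *\<^sub>R T t (A x)) / norm (s - t))
        \<le> M * norm (?q \<bar>s - t\<bar> - A x) + norm (T s (A x) - T t (A x))" .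
    qed
    show "((\<lambda>s. M * norm (?q \<bar>s - t\<bar> - A x) + norm (T s (A x) - T t (A x))) \<longlongrightarrow> 0) (at t within {0..})"
      using lim by (simp only: diff_self norm_zero mult_zero_right add_0_right)
  qed
  then show ?thesis
    unfolding has_vector_derivative_def has_derivative_iff_norm
    by (rule conjI[OF bounded_linear_scaleR_left])
qed

subsection \<open>The resolvent on the positive half-line\<close>

text \<open>Each \<open>T h\<close> is a contraction for the equivalent norm \<open>SUP t. norm (T t x)\<close>.\<close>

lemma hille_yosida_lower_bound:
  assumes x: "x \<in> D" and s: "s \<ge> 0"
  shows "s * norm x \<le> M * norm (s *\<^sub>R x - A x)"
proof -
  define N where "N x = (SUP t\<in>{0..}. norm (T t x))" for x
  have bdd: "bdd_above ((\<lambda>t. norm (T t x)) ` {0..})" for x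
    by (rule bdd_aboveI2[of _ _ "M * norm x"]) (simp add: norm_T_le)
  have N_up: "norm (T t x) \<le> N x" if "t \<ge> 0" for t x
    unfolding N_def by (rule cSUP_upper[OF _ bdd]) (use that in simp)
  have N_le: "N x \<le> M * norm x" for x
    unfolding N_def by (rule cSUP_least) (simp_all add: norm_T_le)
  have N_T: "N (T h x) \<le> N x" if "h \<ge> 0" for h x
    unfolding N_def[of "T h x"]
  proof (rule cSUP_least)
    fix t :: real assume "t \<in> {0..}"
    then show "norm (T t (T h x)) \<le> N x" using T_plus[of t h x] N_up[of "t + h" x] that by simp
  qed simp
  \<comment> \<open>A difference quotient with step \<open>h\<close> stands in for
    \<open>A x\<close>; the limit \<open>h \<rightarrow> 0\<close> is taken at the end.\<close>
  have est: "s * norm x \<le> M * norm (s *\<^sub>R x - (T h x - x) /\<^sub>R h)" if h: "h > 0" for h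
  proof -
    let ?z = "s *\<^sub>R x - (T h x - x) /\<^sub>R h"
    have "(1 + s * h) * N x \<le> h * N ?z + N x"
    proof -
      \<comment> \<open>The triangle inequality is applied at each \<open>t\<close> before the
        supremum is taken, so no norm axioms for \<open>N\<close> have to be established.\<close>
      have "norm (T t x) \<le> (h * N ?z + N x) / (1 + s * h)" if t: "t \<ge> 0" for t
      proof -
        have "(1 + s * h) *\<^sub>R x = h *\<^sub>R ?z + T h x"
          using h by (simp add: algebra_simps)
        then have "T t ((1 + s * h) *\<^sub>R x) = T t (h *\<^sub>R ?z + T h x)" by (rule arg_cong)
        then have "(1 + s * h) *\<^sub>R T t x = h *\<^sub>R T t ?z + T t (T h x)"
          by (simp only: T_scaleR[OF t] T_add[OF t])
        then have "norm ((1 + s * h) *\<^sub>R T t x) \<le> norm (h *\<^sub>R T t ?z) + norm (T t (T h x))"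
          by (simp only: norm_triangle_ineq)
        then have "(1 + s * h) * norm (T t x) \<le> h * norm (T t ?z) + norm (T t (T h x))"
          using h s by (simp only: norm_scaleR abs_of_nonneg add_nonneg_nonneg mult_nonneg_nonneg
            zero_le_one less_imp_le)
        also have "\<dots> \<le> h * N ?z + N x"
          using N_up[OF t, of ?z] order_trans[OF N_up[OF t, of "T h x"] N_T] h
          by (intro add_mono mult_left_mono) auto
        finally show ?thesis using s h by (simp add: pos_le_divide_eq add_pos_nonneg mult.commute)
      qed
      then have "(SUP t\<in>{0..}. norm (T t x)) \<le> (h * N ?z + N x) / (1 + s * h)"
        by (intro cSUP_least) simp_all
      then have "N x \<le> (h * N ?z + N x) / (1 + s * h)" by (simp only: N_def[symmetric])
      then show ?thesis using s h by (simp add: pos_le_divide_eq add_pos_nonneg mult.commute)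
    qed
    then have "h * (s * N x) \<le> h * N ?z" by (simp add: algebra_simps)
    then have "s * N x \<le> N ?z" using h by simp
    moreover have "s * norm x \<le> s * N x" using N_up[of 0 x] s by (simp add: mult_left_mono)
    ultimately show ?thesis using N_le[of ?z] by linarith
  qed
  have lim: "((\<lambda>h. M * norm (s *\<^sub>R x - (T h x - x) /\<^sub>R h)) \<longlongrightarrow> M * norm (s *\<^sub>R x - A x)) (at_right 0)"
    by (intro tendsto_intros D_quotient x)
  show ?thesis
    by (rule tendsto_lowerbound[OF lim])
       (auto simp: eventually_at_right_field intro!: exI[of _ 1] est)
qed

text \<open>The bound of \<open>hille_yosida_lower_bound\<close> degenerates at
  \<open>s = 0\<close>. It still controls \<open>norm (A x)\<close> by
  \<open>(1 + M) * norm (s *\<^sub>R x - A x)\<close>, and the bounded inverse of \<open>A\<close>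
  then controls \<open>norm x\<close>, uniformly in \<open>s\<close>.\<close>

lemma uniform_lower_bound:
  obtains \<mu> where "\<mu> > 0" "\<And>s x. s \<ge> 0 \<Longrightarrow> x \<in> D \<Longrightarrow> \<mu> * norm x \<le> norm (s *\<^sub>R x - A x)"
proof -
  have bij: "bij_betw (\<lambda>x. 0 *\<^sub>C x - A x) D UNIV"
    and bl: "bounded_linear (resolvent D A 0)"
    using zero_resolvent by (auto simp: resolvent_set_def bounded_clinear_imp_linear)
  have z: "0 *\<^sub>C x = 0" for x :: 'h
    using scaleC_of_real[of 0 x] by simp
  obtain b where b: "b > 0" "\<And>x. norm (resolvent D A 0 x) \<le> norm x * b"
    using bounded_linear.pos_bounded[OF bl] by blast
  have A_low: "norm x \<le> b * norm (A x)" if "x \<in> D" for x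
  proof -
    have "resolvent D A 0 (0 *\<^sub>C x - A x) = x"
      unfolding resolvent_def using bij that
      by (intro inv_into_f_f) (auto simp: bij_betw_def)
    then show ?thesis using b(2)[of "- A x"] by (simp add: z mult.commute)
  qed
  show thesis
  proof
    show "1 / (b * (1 + M)) > 0" using b M_pos by simp
    fix s x assume s: "(s::real) \<ge> 0" and x: "x \<in> D"
    have "norm (A x) \<le> norm (s *\<^sub>R x - A x) + s * norm x"
      using norm_triangle_ineq4[of "s *\<^sub>R x" "s *\<^sub>R x - A x"] s by simp
    also have "\<dots> \<le> norm (s *\<^sub>R x - A x) * (1 + M)"
      using hille_yosida_lower_bound[OF x s] by (simp add: algebra_simps)
    finally have "norm x \<le> b * (norm (s *\<^sub>R x - A x) * (1 + M))"
      using A_low[OF x] b(1) by (meson mult_left_mono less_imp_le order_trans)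
    then show "1 / (b * (1 + M)) * norm x \<le> norm (s *\<^sub>R x - A x)"
      using b M_pos by (simp add: pos_divide_le_eq mult_ac)
  qed
qed

text \<open>Continuity method: a uniform lower bound lets surjectivity propagate from \<open>s = 0\<close> in steps
  of fixed length, each step being solved by Banach's fixed point theorem.\<close>

lemma surj_resolvent:
  assumes "s \<ge> 0"
  shows "\<exists>x\<in>D. s *\<^sub>R x - A x = z"
proof -
  obtain \<mu> where \<mu>: "\<mu> > 0" "\<And>s x. s \<ge> 0 \<Longrightarrow> x \<in> D \<Longrightarrow> \<mu> * norm x \<le> norm (s *\<^sub>R x - A x)"
    using uniform_lower_bound by blast
  have "\<forall>s z. 0 \<le> s \<and> s \<le> real n * (\<mu> / 2) \<longrightarrow> (\<exists>x\<in>D. s *\<^sub>R x - A x = z)" for n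
  proof (induction n)
    case 0
    have "bij_betw (\<lambda>x. 0 *\<^sub>C x - A x) D UNIV"
      using zero_resolvent by (auto simp: resolvent_set_def)
    then have "z \<in> (\<lambda>x. 0 *\<^sub>C x - A x) ` D" for z
      by (simp add: bij_betw_def)
    then have "\<exists>x\<in>D. 0 *\<^sub>C x - A x = z" for z
      by (metis (no_types, lifting) imageE)
    moreover have "0 *\<^sub>C x = 0" for x :: 'h
      using scaleC_of_real[of 0 x] by simp
    ultimately have "\<exists>x\<in>D. 0 *\<^sub>R x - A x = z" for z by simp
    moreover have "s = 0" if "0 \<le> s \<and> s \<le> real 0 * (\<mu> / 2)" for s :: real using that by simp
    ultimately show ?case by blast
  next
    case (Suc n)
    show ?case
    proof (intro allI impI)
      fix s z assume s: "0 \<le> s \<and> s \<le> real (Suc n) * (\<mu> / 2)"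
      \<comment> \<open>The point nearest to \<open>s\<close> in the interval where the equation is
        already solvable.\<close>
      define r where "r = min s (real n * (\<mu> / 2))"
      have r: "0 \<le> r" "r \<le> real n * (\<mu> / 2)" "\<bar>s - r\<bar> \<le> \<mu> / 2"
        using s \<mu>(1) by (auto simp: r_def algebra_simps min_def)
      then have "\<forall>z. \<exists>x\<in>D. r *\<^sub>R x - A x = z" using Suc by blast
      then obtain f where f: "\<And>z. f z \<in> D" "\<And>z. r *\<^sub>R f z - A (f z) = z" by metis
      have f_lip: "\<mu> * norm (f z - f w) \<le> norm (z - w)" for z w
      proof -
        have d: "f z - f w \<in> D" "A (f z - f w) = A (f z) - A (f w)"
          using D_comb[OF f(1)[of z] f(1)[of w], of 1 "-1"] by simp_all
        have "r *\<^sub>R (f z - f w) - A (f z - f w) = (r *\<^sub>R f z - A (f z)) - (r *\<^sub>R f w - A (f w))"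
          unfolding d(2) by (simp add: algebra_simps)
        then have "\<mu> * norm (f z - f w) \<le> norm ((r *\<^sub>R f z - A (f z)) - (r *\<^sub>R f w - A (f w)))"
          using \<mu>(2)[OF r(1) d(1)] by simp
        then show ?thesis by (simp add: f(2))
      qed
      \<comment> \<open>A fixed point satisfies the equation at \<open>r\<close> with right-hand
        side \<open>z - (s - r) *\<^sub>R x\<close>, which is the equation at \<open>s\<close>.
        Since \<open>f\<close> has Lipschitz constant \<open>1 / \<mu>\<close> and \<open>s\<close>
        is within \<open>\<mu> / 2\<close> of \<open>r\<close>, the contraction factor is
        \<open>1 / 2\<close>.\<close>
      have "\<exists>!x. f (z - (s - r) *\<^sub>R x) = x"
      proof (rule banach_fix_type[of "1/2"])
        show "\<forall>x y. dist (f (z - (s - r) *\<^sub>R x)) (f (z - (s - r) *\<^sub>R y)) \<le> 1 / 2 * dist x y"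
        proof (intro allI)
          fix x y
          let ?d = "norm (f (z - (s - r) *\<^sub>R x) - f (z - (s - r) *\<^sub>R y))"
          have "\<mu> * ?d \<le> norm ((s - r) *\<^sub>R (y - x))"
            using f_lip[of "z - (s - r) *\<^sub>R x" "z - (s - r) *\<^sub>R y"] by (simp add: algebra_simps)
          also have "\<dots> \<le> \<mu> / 2 * norm (x - y)"
            unfolding norm_scaleR norm_minus_commute[of y x] by (intro mult_right_mono r(3)) simp
          finally have "\<mu> * ?d \<le> \<mu> * (norm (x - y) / 2)" by simp
          then show "dist (f (z - (s - r) *\<^sub>R x)) (f (z - (s - r) *\<^sub>R y)) \<le> 1 / 2 * dist x y"
            using \<mu>(1) by (simp add: dist_norm)
        qed
      qed simp_all
      then obtain x where x: "f (z - (s - r) *\<^sub>R x) = x" by blast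
      then have "r *\<^sub>R x - A x = z - (s - r) *\<^sub>R x" "x \<in> D" using f by metis+
      then show "\<exists>x\<in>D. s *\<^sub>R x - A x = z"
        by (intro bexI[of _ x]) (simp_all add: algebra_simps)
    qed
  qed
  note steps = this
  obtain n where "s / (\<mu> / 2) \<le> real n" using real_arch_simple by blast
  then have "s \<le> real n * (\<mu> / 2)" using \<mu>(1) by (simp add: pos_divide_le_eq)
  then show ?thesis using steps[of n] assms by blast
qed

section \<open>Algebra, bounds and continuity of the resolvent\<close>

abbreviation R :: "real \<Rightarrow> 'h \<Rightarrow> 'h" where
  "R s \<equiv> resolvent D A (complex_of_real s)"

lemma R_D: "s \<ge> 0 \<Longrightarrow> R s z \<in> D"
  and R_eq: "s \<ge> 0 \<Longrightarrow> s *\<^sub>R R s z - A (R s z) = z"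
proof -
  assume "s \<ge> 0"
  then have "z \<in> (\<lambda>x. complex_of_real s *\<^sub>C x - A x) ` D"
    using surj_resolvent[of s z] by (auto simp: scaleC_of_real image_iff)
  from inv_into_into[OF this] f_inv_into_f[OF this]
  show "R s z \<in> D" "s *\<^sub>R R s z - A (R s z) = z"
    by (simp_all add: resolvent_def scaleC_of_real)
qed

text \<open>Injectivity, from the lower bound applied to the difference. Later identities for
  \<open>R s\<close> follow by exhibiting a candidate and checking its equation.\<close>

lemma R_unique:
  assumes "s \<ge> 0" "x \<in> D" "s *\<^sub>R x - A x = z"
  shows "R s z = x"
proof -
  obtain \<mu> where \<mu>: "\<mu> > 0" "\<And>s x. s \<ge> 0 \<Longrightarrow> x \<in> D \<Longrightarrow> \<mu> * norm x \<le> norm (s *\<^sub>R x - A x)"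
    using uniform_lower_bound by blast
  have "R s z - x \<in> D" "A (R s z - x) = A (R s z) - A x"
    using D_comb[OF R_D[OF assms(1), of z] assms(2), of 1 "-1"] by simp_all
  moreover have "s *\<^sub>R (R s z - x) - (A (R s z) - A x) = 0"
    using R_eq[OF assms(1), of z] assms(3) by (simp add: algebra_simps)
  ultimately have "\<mu> * norm (R s z - x) \<le> 0"
    using \<mu>(2)[OF assms(1), of "R s z - x"] by simp
  then show ?thesis using \<mu>(1) by (simp add: mult_le_0_iff)
qed

lemma A_R: "s \<ge> 0 \<Longrightarrow> A (R s z) = s *\<^sub>R R s z - z"
  using R_eq[of s z] by (simp add: algebra_simps)

lemma norm_R_le: "s \<ge> 0 \<Longrightarrow> s * norm (R s z) \<le> M * norm z"
  using hille_yosida_lower_bound[OF R_D, of s s z] by (simp add: R_eq)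

text \<open>Covers \<open>s\<close> near \<open>0\<close>, where \<open>norm_R_le\<close> gives no
  bound.\<close>

lemma norm_R_uniform:
  obtains L where "L > 0" "\<And>s z. s \<ge> 0 \<Longrightarrow> norm (R s z) \<le> L * norm z"
proof -
  obtain \<mu> where \<mu>: "\<mu> > 0" "\<And>s x. s \<ge> 0 \<Longrightarrow> x \<in> D \<Longrightarrow> \<mu> * norm x \<le> norm (s *\<^sub>R x - A x)"
    using uniform_lower_bound by blast
  have "norm (R s z) \<le> 1 / \<mu> * norm z" if "s \<ge> 0" for s z
    using \<mu>(2)[OF that R_D[OF that, of z]] \<mu>(1) by (simp add: R_eq that field_simps)
  then show thesis using that[of "1 / \<mu>"] \<mu>(1) by simp
qed

lemma R_linear:
  assumes "s \<ge> 0"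
  shows "bounded_linear (R s)"
proof -
  obtain L where L: "L > 0" "\<And>s z. s \<ge> 0 \<Longrightarrow> norm (R s z) \<le> L * norm z"
    using norm_R_uniform by blast
  have comb: "R s (a *\<^sub>R x + b *\<^sub>R y) = a *\<^sub>R R s x + b *\<^sub>R R s y" for a b x y
  proof (rule R_unique[OF assms])
    note c = D_comb[OF R_D[OF assms, of x] R_D[OF assms, of y], of a b]
    show "a *\<^sub>R R s x + b *\<^sub>R R s y \<in> D" by (rule c(1))
    show "s *\<^sub>R (a *\<^sub>R R s x + b *\<^sub>R R s y) - A (a *\<^sub>R R s x + b *\<^sub>R R s y) = a *\<^sub>R x + b *\<^sub>R y"
      unfolding c(2) A_R[OF assms] by (simp add: algebra_simps)
  qed
  show ?thesis
  proof (rule bounded_linear_intro)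
    show "R s (x + y) = R s x + R s y" for x y using comb[of 1 x 1 y] by simp
    show "R s (a *\<^sub>R x) = a *\<^sub>R R s x" for a x using comb[of a x 0 x] by simp
    show "norm (R s x) \<le> norm x * L" for x using L(2)[OF assms, of x] by (simp add: mult.commute)
  qed
qed

lemmas R_diff = linear_diff[OF bounded_linear.linear[OF R_linear]]
  and R_add = linear_add[OF bounded_linear.linear[OF R_linear]]
  and R_scaleR = linear_scale[OF bounded_linear.linear[OF R_linear]]

lemma R_A: "s \<ge> 0 \<Longrightarrow> x \<in> D \<Longrightarrow> R s (A x) = s *\<^sub>R R s x - x"
  using R_unique[of s x "s *\<^sub>R x - A x"] by (simp add: R_diff R_scaleR algebra_simps)

lemma resolvent_identity:
  assumes "s \<ge> 0" "r \<ge> 0"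
  shows "R s x - R r x = (r - s) *\<^sub>R R s (R r x)"
  using R_A[OF assms(1) R_D[OF assms(2), of x]] assms
  by (simp add: A_R R_diff R_scaleR algebra_simps)

text \<open>Exchanging \<open>s\<close> and \<open>r\<close> in the resolvent identity flips the
  sign of both the difference and the scalar factor, which cancels when
  \<open>s \<noteq> r\<close>.\<close>

lemma R_commute:
  assumes "s \<ge> 0" "r \<ge> 0"
  shows "R s (R r x) = R r (R s x)"
proof (cases "s = r")
  case False
  have "(r - s) *\<^sub>R R s (R r x) = (r - s) *\<^sub>R R r (R s x)"
    using resolvent_identity[OF assms, of x] resolvent_identity[OF assms(2,1), of x]
    by (metis minus_diff_eq scaleR_minus_left)
  then show ?thesis using False by simp
qed simp

lemma T_R_commute:
  assumes "t \<ge> 0" "s \<ge> 0"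
  shows "T t (R s x) = R s (T t x)"
  by (rule R_unique[symmetric])
     (use assms R_D[OF assms(2), of x] in \<open>simp_all add: T_D A_R T_diff T_scaleR\<close>)

lemma continuous_on_R: "continuous_on {0..} (\<lambda>s. R s x)"
proof -
  obtain L where L: "L > 0" "\<And>s z. s \<ge> 0 \<Longrightarrow> norm (R s z) \<le> L * norm z"
    using norm_R_uniform by blast
  have "(L * L * norm x)-lipschitz_on {0..} (\<lambda>s. R s x)"
  proof (rule lipschitz_onI)
    fix s r :: real assume sr: "s \<in> {0..}" "r \<in> {0..}"
    have "norm (R s x - R r x) = \<bar>r - s\<bar> * norm (R s (R r x))"
      using sr by (simp add: resolvent_identity)
    also have "\<dots> \<le> \<bar>r - s\<bar> * (L * (L * norm x))"
      using sr L by (intro mult_left_mono order_trans[OF L(2)]) auto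
    finally show "dist (R s x) (R r x) \<le> L * L * norm x * dist s r"
      by (simp add: dist_norm abs_minus_commute mult_ac)
  qed (use L(1) in simp)
  then show ?thesis by (rule lipschitz_on_continuous_on)
qed

subsection \<open>Balakrishnan's integral\<close>

text \<open>Near \<open>0\<close> the dominated convergence theory of the library does not apply to values in \<open>'h\<close>;
  writing \<open>R s x = R 0 x - s R s (R 0 x)\<close> leaves a scalar singularity times a fixed vector and a
  continuous remainder.\<close>

lemma frac_power_integrand:
  assumes a: "0 < a" "a < 1"
  shows "(\<lambda>s. s powr (- a) *\<^sub>R R s x) integrable_on {0<..}"
    and "\<exists>C. \<forall>x. norm (integral {0<..} (\<lambda>s. s powr (- a) *\<^sub>R R s x)) \<le> C * norm x"
proof -
  obtain L where L: "L > 0" "\<And>s z. s \<ge> 0 \<Longrightarrow> norm (R s z) \<le> L * norm z"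
    using norm_R_uniform by blast
  let ?f = "\<lambda>x s. s powr (- a) *\<^sub>R R s x"
  have int0: "(\<lambda>s. s powr (- a)) integrable_on {0..1}"
    using has_integral_powr_from_0[of "- a" 1] a by (auto simp: has_integral_integrable)
  have int1: "(\<lambda>s. s powr (- a - 1)) integrable_on {1..}"
    using has_integral_powr_to_inf[of "- a - 1" 1] a by (auto simp: has_integral_integrable)
  have near: "?f x integrable_on {0..1}" for x
  proof -
    have "(\<lambda>s. s powr (- a) *\<^sub>R R 0 x) integrable_on {0..1}"
      using integrable_linear[OF int0 bounded_linear_scaleR_left[of "R 0 x"]] by (simp add: o_def)
    moreover have "(\<lambda>s. s powr (1 - a) *\<^sub>R R s (R 0 x)) integrable_on {0..1}"
    proof (intro integrable_continuous_real continuous_on_scaleR)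
      show "continuous_on {0..1} (\<lambda>s. s powr (1 - a))"
        using a by (intro continuous_on_powr' continuous_on_id continuous_on_const) auto
      show "continuous_on {0..1} (\<lambda>s. R s (R 0 x))"
        by (rule continuous_on_subset[OF continuous_on_R]) auto
    qed
    ultimately have "(\<lambda>s. s powr (- a) *\<^sub>R R 0 x - s powr (1 - a) *\<^sub>R R s (R 0 x)) integrable_on {0..1}"
      by (rule integrable_diff)
    then show ?thesis
    proof (rule integrable_eq)
      fix s :: real assume "s \<in> {0..1}"
      then have r: "R s x = R 0 x - s *\<^sub>R R s (R 0 x)" "s powr (1 - a) = s powr (- a) * s"
        using resolvent_identity[of s 0 x] by (auto simp: algebra_simps powr_diff powr_minus field_simps)
      then show "s powr (- a) *\<^sub>R R 0 x - s powr (1 - a) *\<^sub>R R s (R 0 x) = ?f x s"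
        unfolding r(2) by (subst r(1)) (simp only: scaleR_diff_right scaleR_scaleR)
    qed
  qed
  \<comment> \<open>The decay \<open>M / s\<close> of the resolvent supplies the power that
    \<open>s powr (- a)\<close> lacks for integrability at infinity.\<close>
  have far_le: "norm (?f x s) \<le> M * norm x * s powr (- a - 1)" if "s \<in> {1..}" for x s
  proof -
    have "norm (R s x) \<le> M * norm x / s"
      using norm_R_le[of s x] that by (simp add: field_simps)
    then have "s powr (- a) * norm (R s x) \<le> s powr (- a) * (M * norm x / s)"
      by (rule mult_left_mono) simp
    then show ?thesis using that by (simp add: powr_diff mult_ac)
  qed
  have int1': "(\<lambda>s. M * norm x * s powr (- a - 1)) integrable_on {1..}" for x
    using int1 by (rule integrable_on_mult_right)
  have far: "?f x integrable_on {1..}" for x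
  proof (rule integrable_on_all_intervals_integrable_bound[OF _ far_le int1'])
    fix c d :: real
    have "?f x integrable_on {max 1 c..d}"
      by (intro integrable_continuous_real continuous_intros continuous_on_subset[OF continuous_on_R]) auto
    moreover have "{1..} \<inter> cbox c d = {max 1 c..d}" by auto
    ultimately show "(\<lambda>s. if s \<in> {1..} then ?f x s else 0) integrable_on cbox c d"
      by (simp only: integrable_restrict_Int)
  qed
  \<comment> \<open>The two pieces overlap only in the point \<open>1\<close>, and dropping the
    endpoint \<open>0\<close> also changes only a null set.\<close>
  have eq: "(?f x has_integral (integral {0..1} (?f x) + integral {1..} (?f x))) {0<..}" for x
  proof -
    have "({0..1} \<inter> {1..}) = {1::real}" "{0..1} \<union> {1..} = {0::real..}" by auto
    then have "(?f x has_integral (integral {0..1} (?f x) + integral {1..} (?f x))) {0..}"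
      using has_integral_Un[OF integrable_integral[OF near] integrable_integral[OF far], of x] by simp
    moreover have "negligible {s \<in> {0..} - {0<..}. ?f x s \<noteq> 0}"
      by (rule negligible_subset[OF negligible_sing[of 0]]) auto
    moreover have "negligible {s \<in> {0<..} - {0..}. ?f x s \<noteq> 0}"
      by (rule negligible_subset[OF negligible_empty]) auto
    ultimately show ?thesis
      using has_integral_spike_set_eq[of "{0..}" "{0<..}" "?f x"] by blast
  qed
  show "?f x integrable_on {0<..}" using eq by (rule has_integral_integrable)
  have "norm (integral {0<..} (?f x)) \<le>
      (L * integral {0..1} (\<lambda>s. s powr (- a)) + M * integral {1..} (\<lambda>s. s powr (- a - 1))) * norm x" for x
  proof -
    have "norm (integral {0..1} (?f x)) \<le> integral {0..1} (\<lambda>s. (L * norm x) * s powr (- a))"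
    proof (intro integral_norm_bound_integral near integrable_on_mult_right int0)
      fix s :: real assume "s \<in> {0..1}"
      then have "s powr (- a) * norm (R s x) \<le> s powr (- a) * (L * norm x)"
        by (intro mult_left_mono L(2)) auto
      then show "norm (?f x s) \<le> L * norm x * s powr (- a)" by (simp add: mult_ac)
    qed
    moreover have "norm (integral {1..} (?f x)) \<le> integral {1..} (\<lambda>s. M * norm x * s powr (- a - 1))"
      by (intro integral_norm_bound_integral far int1' far_le)
    ultimately show ?thesis
      using norm_triangle_ineq[of "integral {0..1} (?f x)" "integral {1..} (?f x)"]
      by (simp add: integral_unique[OF eq] algebra_simps)
  qed
  then show "\<exists>C. \<forall>x. norm (integral {0<..} (?f x)) \<le> C * norm x" by blast
qed

section \<open>Negative fractional powers as bounded operators and their commutation\<close>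

lemma neg_frac_power_inv_aux_linear:
  assumes "0 \<le> a" "a < 1"
  shows "bounded_linear (neg_frac_power_inv_aux D A a)"
proof (cases "a = 0")
  case True
  then show ?thesis by (simp add: neg_frac_power_inv_aux_def[abs_def])
next
  case False
  then have a: "0 < a" "a < 1" using assms by auto
  let ?f = "\<lambda>x s. s powr (- a) *\<^sub>R R s x"
  obtain C where C: "\<And>x. norm (integral {0<..} (?f x)) \<le> C * norm x"
    using frac_power_integrand(2)[OF a] by blast
  have "bounded_linear (\<lambda>x. integral {0<..} (?f x))"
  proof (rule bounded_linear_intro)
    show "integral {0<..} (?f (x + y)) = integral {0<..} (?f x) + integral {0<..} (?f y)" for x y
      by (subst integral_add[symmetric, OF frac_power_integrand(1)[OF a] frac_power_integrand(1)[OF a]])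
         (auto intro!: integral_cong simp: R_add scaleR_add_right)
    show "integral {0<..} (?f (c *\<^sub>R x)) = c *\<^sub>R integral {0<..} (?f x)" for c x
      by (subst integral_cmul[symmetric]) (auto intro!: integral_cong simp: R_scaleR)
    show "norm (integral {0<..} (?f x)) \<le> norm x * C" for x using C[of x] by (simp add: mult.commute)
  qed
  then have "bounded_linear (\<lambda>x. (sin (pi * a) / pi) *\<^sub>R integral {0<..} (?f x))"
    by (rule bounded_linear_const_scaleR)
  moreover have "neg_frac_power_inv_aux D A a = (\<lambda>x. (sin (pi * a) / pi) *\<^sub>R integral {0<..} (?f x))"
    by (rule ext) (simp add: neg_frac_power_inv_aux_def False)
  ultimately show ?thesis by simp
qed

text \<open>A bounded operator passes under the integral and then past each resolvent. The operators
  of interest are \<open>T t\<close> and \<open>R s\<close>.\<close>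

lemma neg_frac_power_inv_aux_commute:
  assumes "0 \<le> a" "a < 1" "bounded_linear S" "\<And>s x. s \<ge> 0 \<Longrightarrow> S (R s x) = R s (S x)"
  shows "S (neg_frac_power_inv_aux D A a x) = neg_frac_power_inv_aux D A a (S x)"
proof (cases "a = 0")
  case False
  then have a: "0 < a" "a < 1" using assms by auto
  have "S (integral {0<..} (\<lambda>s. s powr (- a) *\<^sub>R R s x)) =
      integral {0<..} (S \<circ> (\<lambda>s. s powr (- a) *\<^sub>R R s x))"
    by (rule integral_linear[symmetric, OF frac_power_integrand(1)[OF a] assms(3)])
  also have "\<dots> = integral {0<..} (\<lambda>s. s powr (- a) *\<^sub>R R s (S x))"
    by (rule integral_cong) (simp add: assms(4) linear_scale[OF bounded_linear.linear[OF assms(3)]])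
  finally show ?thesis
    using False by (simp add: neg_frac_power_inv_aux_def linear_scale[OF bounded_linear.linear[OF assms(3)]])
qed (simp add: neg_frac_power_inv_aux_def)

lemma neg_frac_power_inv_linear: "bounded_linear (neg_frac_power_inv D A b)"
  unfolding neg_frac_power_inv_def comp_def
  by (intro bounded_linear_compose[OF bounded_linear_funpow] neg_frac_power_inv_aux_linear)
     (use R_linear[of 0] in \<open>simp_all add: frac_lt_1\<close>)

lemma neg_frac_power_inv_commute:
  assumes "bounded_linear S" "\<And>s x. s \<ge> 0 \<Longrightarrow> S (R s x) = R s (S x)"
  shows "S (neg_frac_power_inv D A b x) = neg_frac_power_inv D A b (S x)"
  using funpow_commute_with[of S "R 0"] assms(2)[of 0]
  by (simp add: neg_frac_power_inv_def neg_frac_power_inv_aux_commute[OF _ _ assms] frac_lt_1)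

text \<open>The fractional part is unchanged, so only two more factors \<open>R 0\<close> appear;
  \<open>b \<ge> 0\<close> keeps \<open>nat\<close> from truncating.\<close>

lemma neg_frac_power_inv_add_2:
  assumes "b \<ge> 0"
  shows "neg_frac_power_inv D A (b + 2) x = R 0 (R 0 (neg_frac_power_inv D A b x))"
proof -
  have "nat \<lfloor>b + 2\<rfloor> = Suc (Suc (nat \<lfloor>b\<rfloor>))" using assms by (simp add: nat_add_distrib)
  moreover have "frac (b + 2) = frac b" by (simp add: frac_def)
  ultimately show ?thesis by (simp add: neg_frac_power_inv_def)
qed

section \<open>Energy estimates for the Cayley transform\<close>

text \<open>Eliminates the unbounded \<open>A\<close>: every linear map that commutes with
  \<open>R 1\<close> now visibly commutes with the Cayley transform.\<close>

lemma cayley_eq: "cayley D A x = 2 *\<^sub>R R 1 x - x"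
  using A_R[of 1 x] by (simp add: cayley_def scaleR_2)

lemma R_cayley_commute: "R 1 (cayley D A x) = cayley D A (R 1 x)"
  by (simp only: cayley_eq R_diff R_scaleR zero_le_one)

text \<open>With \<open>y = R 1 x\<close> and \<open>f t = P (T t y)\<close>, the orbits of
  \<open>cayley D A x\<close> and \<open>x\<close> under \<open>P\<close> are \<open>f + f'\<close>
  and \<open>f - f'\<close>. The difference of their squared norms is four times the inner product
  of \<open>f\<close> and \<open>f'\<close>, that is, twice the derivative of the squared norm of
  \<open>f\<close>. Integrating this by parts against \<open>w\<close> gives the claim.\<close>

lemma energy_identity:
  fixes P :: "'h \<Rightarrow> 'h"
  assumes P: "bounded_linear P" and \<tau>: "\<tau> \<ge> 0"
    and w: "\<And>t. t \<in> {0..\<tau>} \<Longrightarrow> (w has_vector_derivative w' t) (at t within {0..\<tau>})"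
    and w': "continuous_on {0..\<tau>} w'"
  shows "integral {0..\<tau>} (\<lambda>t. w t * (norm (P (T t (cayley D A x))))\<^sup>2) =
      integral {0..\<tau>} (\<lambda>t. w t * (norm (P (T t x)))\<^sup>2)
      + 2 * w \<tau> * (norm (P (T \<tau> (R 1 x))))\<^sup>2 - 2 * w 0 * (norm (P (R 1 x)))\<^sup>2
      - 2 * integral {0..\<tau>} (\<lambda>t. w' t * (norm (P (T t (R 1 x))))\<^sup>2)"
proof -
  define y where "y = R 1 x"
  have y: "y \<in> D" unfolding y_def by (rule R_D) simp
  have Ay: "A y = y - x" unfolding y_def by (subst A_R) simp_all
  define f f' where "f t = P (T t y)" and "f' t = P (T t (A y))" for t
  have PT_diff: "P (T t (u - v)) = P (T t u) - P (T t v)" if "t \<ge> 0" for t u v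
    using T_diff[OF that] linear_diff[OF bounded_linear.linear[OF P]] by metis
  have PT_add: "P (T t (u + v)) = P (T t u) + P (T t v)" if "t \<ge> 0" for t u v
    using T_add[OF that] linear_add[OF bounded_linear.linear[OF P]] by metis
  have Vx: "P (T t (cayley D A x)) = f t + f' t" and x: "P (T t x) = f t - f' t" if "t \<ge> 0" for t
  proof -
    have "cayley D A x = y + A y" "x = y - A y"
      unfolding Ay by (simp_all add: cayley_eq y_def scaleR_2)
    then show "P (T t (cayley D A x)) = f t + f' t" "P (T t x) = f t - f' t"
      unfolding f_def f'_def using PT_add[OF that] PT_diff[OF that] by metis+
  qed
  have cont: "continuous_on {0..\<tau>} (\<lambda>t. P (T t z))" for z
    by (rule bounded_linear.continuous_on[OF P continuous_on_subset[OF continuous_on_T]]) auto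
  have cont_w: "continuous_on {0..\<tau>} w"
    using w by (rule continuous_on_vector_derivative)
  have int: "(\<lambda>t. v t * (norm (P (T t z)))\<^sup>2) integrable_on {0..\<tau>}"
    if "continuous_on {0..\<tau>} v" for v :: "real \<Rightarrow> real" and z
    by (intro integrable_continuous_real continuous_intros cont that)
  have "((\<lambda>t. w t * (f t \<bullet> f' t + f' t \<bullet> f t) + w' t * (f t \<bullet> f t)) has_integral
      w \<tau> * (f \<tau> \<bullet> f \<tau>) - w 0 * (f 0 \<bullet> f 0)) {0..\<tau>}"
  proof (rule fundamental_theorem_of_calculus[OF \<tau>])
    fix t assume t: "t \<in> {0..\<tau>}"
    have "((\<lambda>t. T t y) has_vector_derivative T t (A y)) (at t within {0..\<tau>})"
      by (rule has_vector_derivative_within_subset[OF T_has_vector_derivative[OF y]]) (use t in auto)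
    then have "(f has_vector_derivative f' t) (at t within {0..\<tau>})"
      unfolding f_def f'_def by (rule bounded_linear.has_vector_derivative[OF P])
    then have "((\<lambda>t. f t \<bullet> f t) has_vector_derivative f t \<bullet> f' t + f' t \<bullet> f t) (at t within {0..\<tau>})"
      by (intro bounded_bilinear.has_vector_derivative[OF bounded_bilinear_inner])
    then show "((\<lambda>t. w t * (f t \<bullet> f t)) has_vector_derivative
        w t * (f t \<bullet> f' t + f' t \<bullet> f t) + w' t * (f t \<bullet> f t)) (at t within {0..\<tau>})"
      by (rule has_vector_derivative_mult[OF w[OF t]])
  qed
  \<comment> \<open>The factor \<open>2\<close> matches the polarization identity: the product rule
    yields only two of the four inner products.\<close>
  from has_integral_mult_right[OF this, of 2]
  have ftc: "((\<lambda>t. 2 * (w t * (f t \<bullet> f' t + f' t \<bullet> f t) + w' t * (f t \<bullet> f t))) has_integral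
      2 * (w \<tau> * (f \<tau> \<bullet> f \<tau>) - w 0 * (f 0 \<bullet> f 0))) {0..\<tau>}" .
  have "((\<lambda>t. (w t * (norm (P (T t (cayley D A x))))\<^sup>2 - w t * (norm (P (T t x)))\<^sup>2)
        + 2 * (w' t * (norm (P (T t y)))\<^sup>2)) has_integral
      (integral {0..\<tau>} (\<lambda>t. w t * (norm (P (T t (cayley D A x))))\<^sup>2)
       - integral {0..\<tau>} (\<lambda>t. w t * (norm (P (T t x)))\<^sup>2)
       + 2 * integral {0..\<tau>} (\<lambda>t. w' t * (norm (P (T t y)))\<^sup>2))) {0..\<tau>}"
    by (intro has_integral_add has_integral_diff has_integral_mult_right integrable_integral int cont_w w')
  moreover have "(w t * (norm (P (T t (cayley D A x))))\<^sup>2 - w t * (norm (P (T t x)))\<^sup>2)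
        + 2 * (w' t * (norm (P (T t y)))\<^sup>2) =
      2 * (w t * (f t \<bullet> f' t + f' t \<bullet> f t) + w' t * (f t \<bullet> f t))" if "t \<in> {0..\<tau>}" for t
  proof -
    have t: "t \<ge> 0" using that by simp
    show ?thesis
      unfolding Vx[OF t] x[OF t] f_def[of t, symmetric] power2_norm_eq_inner
      by (simp add: inner_add inner_diff inner_commute[of "f' t" "f t"] algebra_simps)
  qed
  ultimately have "((\<lambda>t. 2 * (w t * (f t \<bullet> f' t + f' t \<bullet> f t) + w' t * (f t \<bullet> f t))) has_integral
      (integral {0..\<tau>} (\<lambda>t. w t * (norm (P (T t (cayley D A x))))\<^sup>2)
       - integral {0..\<tau>} (\<lambda>t. w t * (norm (P (T t x)))\<^sup>2)
       + 2 * integral {0..\<tau>} (\<lambda>t. w' t * (norm (P (T t y)))\<^sup>2))) {0..\<tau>}"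
    by (rule has_integral_eq[rotated])
  from has_integral_unique[OF this ftc]
  show ?thesis
    unfolding f_def T_zero by (simp only: power2_norm_eq_inner y_def[symmetric]) (simp add: algebra_simps)
qed

text \<open>The integrand is at most a constant times \<open>1 / (1 + t)\<close>, whence the
  logarithm.\<close>

lemma weighted_energy_bound:
  assumes "bounded_linear P" "C \<ge> 0" "\<And>t. t \<ge> 0 \<Longrightarrow> norm (P (T t z)) \<le> C / (1 + t) * norm z"
    and "\<tau> \<ge> 0"
  shows "integral {0..\<tau>} (\<lambda>t. t * (norm (P (T t z)))\<^sup>2) \<le> C\<^sup>2 * ln (1 + \<tau>) * (norm z)\<^sup>2"
proof -
  have "((\<lambda>t. 1 / (1 + t)) has_integral ln (1 + \<tau>) - ln (1 + 0)) {0..\<tau>}"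
    by (rule fundamental_theorem_of_calculus[OF assms(4)])
       (auto intro!: derivative_eq_intros simp flip: has_real_derivative_iff_has_vector_derivative)
  from has_integral_mult_right[OF this, of "C\<^sup>2 * (norm z)\<^sup>2"]
  have log: "((\<lambda>t. C\<^sup>2 * (norm z)\<^sup>2 * (1 / (1 + t))) has_integral C\<^sup>2 * (norm z)\<^sup>2 * ln (1 + \<tau>)) {0..\<tau>}"
    by simp
  have cont: "continuous_on {0..\<tau>} (\<lambda>t. P (T t z))"
    by (rule bounded_linear.continuous_on[OF assms(1) continuous_on_subset[OF continuous_on_T]]) auto
  have "integral {0..\<tau>} (\<lambda>t. t * (norm (P (T t z)))\<^sup>2) \<le>
      integral {0..\<tau>} (\<lambda>t. C\<^sup>2 * (norm z)\<^sup>2 * (1 / (1 + t)))"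
  proof (rule integral_le)
    show "(\<lambda>t. t * (norm (P (T t z)))\<^sup>2) integrable_on {0..\<tau>}"
      by (intro integrable_continuous_real continuous_intros cont)
    show "(\<lambda>t. C\<^sup>2 * (norm z)\<^sup>2 * (1 / (1 + t))) integrable_on {0..\<tau>}"
      using log by (rule has_integral_integrable)
    fix t assume t: "t \<in> {0..\<tau>}"
    have "t * (norm (P (T t z)))\<^sup>2 \<le> (1 + t) * (C / (1 + t) * norm z)\<^sup>2"
      using t by (intro mult_mono power_mono assms(3)) auto
    also have "\<dots> = C\<^sup>2 * (norm z)\<^sup>2 * (1 / (1 + t))"
      using t by (simp add: power2_eq_square)
    finally show "t * (norm (P (T t z)))\<^sup>2 \<le> C\<^sup>2 * (norm z)\<^sup>2 * (1 / (1 + t))" .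
  qed
  then show ?thesis by (simp only: integral_unique[OF log]) (simp add: mult_ac)
qed

text \<open>The time horizon of the energies equals the number \<open>n\<close> of steps. The
  boundary terms at time \<open>n\<close> are then of order \<open>1 / n\<^sup>2\<close>, so
  \<open>n\<close> of them with weights up to \<open>n\<close> add up to a constant.\<close>

lemma cayley_orbit_decay:
  fixes P :: "'h \<Rightarrow> 'h"
  assumes P: "bounded_linear P" and PR: "\<And>x. P (R 1 x) = R 1 (P x)"
    and C: "C \<ge> 0" "\<And>t x. t \<ge> 0 \<Longrightarrow> norm (P (T t x)) \<le> C / (1 + t) * norm x"
    and K: "K \<ge> 0" "\<And>k x. norm ((cayley D A ^^ k) x) \<le> K * norm x"
  shows "(real n)\<^sup>2 * (norm (P (R 1 (R 1 ((cayley D A ^^ n) x)))))\<^sup>2 \<le>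
    K\<^sup>2 * (C\<^sup>2 * ln (1 + real n) + 2 * (C * M * K)\<^sup>2 + 2 * (C * M\<^sup>2 * K)\<^sup>2) * (norm x)\<^sup>2"
proof -
  define X where "X k = (cayley D A ^^ k) x" for k
  define E1 where "E1 z = integral {0..real n} (\<lambda>t. (norm (P (T t z)))\<^sup>2)" for z
  define E2 where "E2 z = integral {0..real n} (\<lambda>t. t * (norm (P (T t z)))\<^sup>2)" for z
  \<comment> \<open>\<open>p\<close> is the quantity to be estimated; \<open>r\<close> and
    \<open>q\<close> are the boundary terms at time \<open>n\<close> in the identities with weights
    \<open>t\<close> and \<open>1\<close>.\<close>
  define p where "p k = (norm (P (R 1 (R 1 (X k)))))\<^sup>2" for k
  define r where "r k = (norm (P (T n (R 1 (X k)))))\<^sup>2" for k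
  define q where "q k = (norm (P (T n (R 1 (R 1 (X k))))))\<^sup>2" for k
  have X_Suc: "X (Suc k) = cayley D A (X k)" for k by (simp add: X_def)
  have X_le: "norm (X k) \<le> K * norm x" for k unfolding X_def by (rule K)
  have R1_le: "norm (R 1 z) \<le> M * norm z" for z using norm_R_le[of 1 z] by simp
  have id1: "E1 (cayley D A z) = E1 z + 2 * (norm (P (T n (R 1 z))))\<^sup>2 - 2 * (norm (P (R 1 z)))\<^sup>2" for z
    using energy_identity[OF P, of "real n" "\<lambda>t. 1" "\<lambda>t. 0" z] by (simp add: E1_def)
  have id2: "E2 (cayley D A z) = E2 z + 2 * real n * (norm (P (T n (R 1 z))))\<^sup>2 - 2 * E1 (R 1 z)" for z
    using energy_identity[OF P, of "real n" "\<lambda>t. t" "\<lambda>t. 1" z] by (simp add: E1_def E2_def)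
  have E_nonneg: "E1 z \<ge> 0" "E2 z \<ge> 0" for z
    unfolding E1_def E2_def by (rule Henstock_Kurzweil_Integration.integral_nonneg;
      auto intro!: integrable_continuous_real continuous_intros bounded_linear.continuous_on[OF P]
        continuous_on_subset[OF continuous_on_T])+
  have r_le: "real n * real n * r k \<le> (C * M * K)\<^sup>2 * (norm x)\<^sup>2"
    and q_le: "real n * real n * q k \<le> (C * M\<^sup>2 * K)\<^sup>2 * (norm x)\<^sup>2" for k
  proof -
    have scaled: "real n * norm (P (T n z)) \<le> C * norm z" for z
    proof -
      have "real n * norm (P (T n z)) \<le> real n * (C / (1 + real n) * norm z)"
        by (intro mult_left_mono C) auto
      also have "\<dots> = real n / (1 + real n) * (C * norm z)" by simp
      also have "\<dots> \<le> 1 * (C * norm z)"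
        using C(1) by (intro mult_right_mono) auto
      finally show ?thesis by simp
    qed
    have R_X: "norm (R 1 (X k)) \<le> M * (K * norm x)"
      using R1_le[of "X k"] mult_left_mono[OF X_le[of k], of M] M_pos by linarith
    have "real n * norm (P (T n (R 1 (X k)))) \<le> C * M * K * norm x"
      using scaled[of "R 1 (X k)"] mult_left_mono[OF R_X C(1)] by (simp add: mult.assoc)
    from power_mono[OF this, of 2]
    show "real n * real n * r k \<le> (C * M * K)\<^sup>2 * (norm x)\<^sup>2"
      by (simp add: r_def power_mult_distrib flip: power2_eq_square)
    have "norm (R 1 (R 1 (X k))) \<le> M * (M * (K * norm x))"
      using R1_le[of "R 1 (X k)"] mult_left_mono[OF R_X, of M] M_pos by linarith
    then have "real n * norm (P (T n (R 1 (R 1 (X k))))) \<le> C * M\<^sup>2 * K * norm x"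
      using scaled[of "R 1 (R 1 (X k))"] mult_left_mono[OF _ C(1)]
      by (fastforce simp: mult.assoc power2_eq_square)
    from power_mono[OF this, of 2]
    show "real n * real n * q k \<le> (C * M\<^sup>2 * K)\<^sup>2 * (norm x)\<^sup>2"
      by (simp add: q_def power_mult_distrib flip: power2_eq_square)
  qed
  \<comment> \<open>\<open>id2\<close> telescopes along the orbit.\<close>
  have sum1: "(\<Sum>k<m. 2 * E1 (R 1 (X k))) = E2 x - E2 (X m) + (\<Sum>k<m. 2 * real n * r k)" for m
  proof (induction m)
    case 0
    show ?case by (simp add: X_def)
  next
    case (Suc m)
    then show ?case using id2[of "X m"] by (simp add: X_Suc r_def)
  qed
  \<comment> \<open>Summation by parts of \<open>id1\<close> at \<open>R 1 (X k)\<close>: the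
    weights \<open>k + 1\<close> turn the differences of \<open>E1\<close> into a plain sum, which
    \<open>sum1\<close> controls.\<close>
  have sum2: "(\<Sum>k<m. real (Suc k) * (2 * p k)) =
      (\<Sum>k<m. E1 (R 1 (X k))) - real m * E1 (R 1 (X m)) + (\<Sum>k<m. real (Suc k) * (2 * q k))" for m
  proof (induction m)
    case (Suc m)
    have "2 * p m = E1 (R 1 (X m)) - E1 (R 1 (X (Suc m))) + 2 * q m"
      using id1[of "R 1 (X m)"] unfolding X_Suc p_def q_def R_cayley_commute by linarith
    then show ?case by (simp only: sum.lessThan_Suc Suc) (simp add: algebra_simps)
  qed simp
  \<comment> \<open>Power boundedness enters: \<open>?B\<close> commutes with \<open>?V\<close>, so
    \<open>?B (X n)\<close> arises from \<open>?B (X k)\<close> by \<open>n - k\<close> further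
    steps.\<close>
  have comp: "p n \<le> K\<^sup>2 * p k" if "k \<le> n" for k
  proof -
    let ?V = "cayley D A"
    let ?B = "\<lambda>z. P (R 1 (R 1 z))"
    have PV: "P (?V z) = ?V (P z)" for z
      unfolding cayley_eq linear_diff[OF bounded_linear.linear[OF P]]
        linear_scale[OF bounded_linear.linear[OF P]] PR ..
    have "?B (X n) = ?B ((?V ^^ (n - k)) (X k))"
      unfolding X_def using that by (simp flip: funpow_add[THEN fun_cong, unfolded comp_def])
    also have "\<dots> = (?V ^^ (n - k)) (?B (X k))"
      by (rule funpow_commute_with) (simp only: R_cayley_commute PV)
    finally have "norm (?B (X n)) \<le> K * norm (?B (X k))" using K(2) by simp
    from power_mono[OF this, of 2] show ?thesis by (simp add: p_def power_mult_distrib)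
  qed
  have double_sum: "(\<Sum>k<m. 2 * real (Suc k)) = real m * (real m + 1)" for m
    by (induction m) (auto simp: algebra_simps)
  have "(\<Sum>k<n. 2 * E1 (R 1 (X k))) \<le> C\<^sup>2 * ln (1 + real n) * (norm x)\<^sup>2 + 2 * (C * M * K)\<^sup>2 * (norm x)\<^sup>2"
  proof -
    have "E2 x \<le> C\<^sup>2 * ln (1 + real n) * (norm x)\<^sup>2"
      unfolding E2_def by (rule weighted_energy_bound[OF P C]) auto
    moreover have "(\<Sum>k<n. 2 * real n * r k) \<le> 2 * (C * M * K)\<^sup>2 * (norm x)\<^sup>2"
    proof (cases "n = 0")
      case False
      have "2 * real n * r k \<le> 2 * (C * M * K)\<^sup>2 * (norm x)\<^sup>2 / real n" for k
        using r_le[of k] False by (simp add: field_simps)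
      then have "(\<Sum>k<n. 2 * real n * r k) \<le> real (card {..<n}) * (2 * (C * M * K)\<^sup>2 * (norm x)\<^sup>2 / real n)"
        by (intro sum_bounded_above)
      then show ?thesis using False by simp
    qed simp
    ultimately show ?thesis using sum1[of n] E_nonneg(2)[of "X n"] by linarith
  qed
  moreover have "(\<Sum>k<n. real (Suc k) * (2 * q k)) \<le> 2 * (C * M\<^sup>2 * K)\<^sup>2 * (norm x)\<^sup>2"
  proof (cases "n = 0")
    case False
    have "real (Suc k) * (2 * q k) \<le> 2 * (C * M\<^sup>2 * K)\<^sup>2 * (norm x)\<^sup>2 / real n" if "k \<in> {..<n}" for k
    proof -
      have "real (Suc k) * (2 * q k) \<le> real n * (2 * q k)"
        using that by (intro mult_right_mono) (auto simp: q_def)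
      also have "\<dots> \<le> 2 * (C * M\<^sup>2 * K)\<^sup>2 * (norm x)\<^sup>2 / real n"
        using q_le[of k] False by (simp add: field_simps)
      finally show ?thesis .
    qed
    then have "(\<Sum>k<n. real (Suc k) * (2 * q k)) \<le>
        real (card {..<n}) * (2 * (C * M\<^sup>2 * K)\<^sup>2 * (norm x)\<^sup>2 / real n)"
      by (intro sum_bounded_above)
    then show ?thesis using False by simp
  qed simp
  moreover have "(\<Sum>k<n. E1 (R 1 (X k))) \<le> (\<Sum>k<n. 2 * E1 (R 1 (X k)))"
    using E_nonneg(1) by (intro sum_mono) simp
  moreover have "0 \<le> real n * E1 (R 1 (X n))" using E_nonneg(1) by simp
  ultimately have S: "(\<Sum>k<n. real (Suc k) * (2 * p k)) \<le>
      C\<^sup>2 * ln (1 + real n) * (norm x)\<^sup>2 + 2 * (C * M * K)\<^sup>2 * (norm x)\<^sup>2 + 2 * (C * M\<^sup>2 * K)\<^sup>2 * (norm x)\<^sup>2"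
    unfolding sum2[of n] by linarith
  \<comment> \<open>Since each \<open>p k\<close> dominates \<open>p n\<close> up to
    \<open>K\<^sup>2\<close>, the weighted sum \<open>S\<close> bounds \<open>p n\<close> times the
    total weight \<open>n * (n + 1)\<close>.\<close>
  have "(real n)\<^sup>2 * p n \<le> real n * (real n + 1) * p n"
    by (intro mult_right_mono) (auto simp: p_def power2_eq_square distrib_left)
  also have "\<dots> = (\<Sum>k<n. real (Suc k) * (2 * p n))"
    by (simp only: double_sum[symmetric] sum_distrib_right) (simp add: mult_ac)
  also have "\<dots> \<le> (\<Sum>k<n. real (Suc k) * (2 * (K\<^sup>2 * p k)))"
    by (intro sum_mono mult_left_mono comp) auto
  also have "\<dots> = K\<^sup>2 * (\<Sum>k<n. real (Suc k) * (2 * p k))"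
    by (simp only: sum_distrib_left mult_ac)
  also have "\<dots> \<le> K\<^sup>2 * (C\<^sup>2 * ln (1 + real n) * (norm x)\<^sup>2 + 2 * (C * M * K)\<^sup>2 * (norm x)\<^sup>2
      + 2 * (C * M\<^sup>2 * K)\<^sup>2 * (norm x)\<^sup>2)"
    by (intro mult_left_mono S) simp
  finally show ?thesis by (simp add: p_def X_def algebra_simps)
qed

section \<open>Decay of the Cayley transform\<close>

text \<open>The resolvent identity between \<open>1\<close> and \<open>0\<close> reads
  \<open>R 0 z = R 1 (z + R 0 z)\<close>. Used twice, it trades the two factors \<open>R 0\<close>
  for the factors \<open>R 1\<close> of the energy estimate and a bounded operator acting on
  \<open>x\<close>.\<close>

lemma frac_power_cayley_eq:
  assumes "b \<ge> 0"
  shows "(cayley D A ^^ n) (neg_frac_power_inv D A (b + 2) x) =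
    neg_frac_power_inv D A b (R 1 (R 1 ((cayley D A ^^ n) ((\<lambda>z. z + R 0 z) ((\<lambda>z. z + R 0 z) x)))))"
proof -
  let ?P = "neg_frac_power_inv D A b" and ?V = "cayley D A" and ?W = "\<lambda>z. z + R 0 z"
  note P_lin = bounded_linear.linear[OF neg_frac_power_inv_linear[of b]]
  have P_R: "?P (R s z) = R s (?P z)" if "s \<ge> 0" for s z
    using neg_frac_power_inv_commute[OF R_linear[OF that]] R_commute[OF that] by metis
  have R0: "R 0 z = R 1 (?W z)" for z
    using resolvent_identity[of 1 0 z] by (simp only: R_add zero_le_one order_refl) (simp add: algebra_simps)
  have W_R1: "?W (R 1 z) = R 1 (?W z)" for z
    by (simp only: R_add R_commute[of 0 1] zero_le_one order_refl)
  have PV: "?P (?V z) = ?V (?P z)" for z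
    by (simp only: cayley_eq linear_diff[OF P_lin] linear_scale[OF P_lin] P_R zero_le_one)
  have "?P (R 1 (R 1 ((?V ^^ n) (?W (?W x))))) = (?V ^^ n) (?P (R 1 (R 1 (?W (?W x)))))"
    by (rule funpow_commute_with[where S = "\<lambda>z. ?P (R 1 (R 1 z))"]) (simp only: R_cayley_commute PV)
  also have "R 1 (R 1 (?W (?W x))) = R 0 (R 0 x)"
  proof -
    have "?W (R 0 x) = ?W (R 1 (?W x))" by (rule arg_cong[where f = ?W, OF R0])
    then have "R 1 (?W (?W x)) = ?W (R 0 x)" by (simp only: W_R1)
    then have "R 1 (R 1 (?W (?W x))) = R 1 (?W (R 0 x))" by (rule arg_cong)
    also have "\<dots> = R 0 (R 0 x)" by (rule R0[symmetric])
    finally show ?thesis .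
  qed
  also have "?P (R 0 (R 0 x)) = neg_frac_power_inv D A (b + 2) x"
    using neg_frac_power_inv_add_2[OF assms] P_R[of 0] by simp
  finally show ?thesis by simp
qed

lemma frac_power_cayley_decay:
  assumes b: "b \<ge> 0"
    and C: "C \<ge> 0" "\<And>t x. t \<ge> 0 \<Longrightarrow> norm (T t (neg_frac_power_inv D A b x)) \<le> C / (1 + t) * norm x"
    and K: "K \<ge> 0" "\<And>k x. norm ((cayley D A ^^ k) x) \<le> K * norm x"
  obtains c where "c \<ge> 0" "\<And>n x. n \<ge> 3 \<Longrightarrow>
    norm ((cayley D A ^^ n) (neg_frac_power_inv D A (b + 2) x)) \<le> c * (sqrt (ln n) / n) * norm x"
proof -
  let ?P = "neg_frac_power_inv D A b" and ?W = "\<lambda>z. z + R 0 z"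
  obtain L where L: "L > 0" "\<And>s z. s \<ge> 0 \<Longrightarrow> norm (R s z) \<le> L * norm z"
    using norm_R_uniform by blast
  have W_le: "norm (?W z) \<le> (1 + L) * norm z" for z
    using norm_triangle_ineq[of z "R 0 z"] L(2)[of 0 z] by (simp add: algebra_simps)
  have PT: "norm (?P (T t x)) \<le> C / (1 + t) * norm x" if "t \<ge> 0" for t x
    using neg_frac_power_inv_commute[OF T_linear[OF that] T_R_commute[OF that]] C(2)[OF that]
    by metis
  have PR: "?P (R 1 z) = R 1 (?P z)" for z
    using neg_frac_power_inv_commute[OF R_linear, of 1] R_commute[of 1] by simp
  \<comment> \<open>The coefficient \<open>2\<close> of \<open>C\<^sup>2\<close> comes from
    \<open>ln (1 + n) \<le> 2 * ln n\<close>; the other two terms are absorbed by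
    \<open>ln n \<ge> 1\<close>. Both inequalities hold for \<open>n \<ge> 3\<close>.\<close>
  define B where "B = 2 * C\<^sup>2 + 2 * (C * M * K)\<^sup>2 + 2 * (C * M\<^sup>2 * K)\<^sup>2"
  have B: "B \<ge> 0" by (simp add: B_def)
  have main: "real n * norm (?P (R 1 (R 1 ((cayley D A ^^ n) x)))) \<le> K * sqrt B * sqrt (ln n) * norm x"
    if n: "n \<ge> 3" for n x
  proof -
    have ln_ge: "ln (real n) \<ge> 1"
      using exp_le n by (subst ln_ge_iff) auto
    have "3 * real n \<le> real n * real n" using n by (intro mult_right_mono) auto
    then have "1 + real n \<le> real n * real n" using n by linarith
    then have "ln (1 + real n) \<le> ln (real n * real n)" using n by (subst ln_le_cancel_iff) auto
    then have ln_le: "ln (1 + real n) \<le> 2 * ln n" using n by (simp add: ln_mult)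
    have "C\<^sup>2 * ln (1 + real n) + 2 * (C * M * K)\<^sup>2 + 2 * (C * M\<^sup>2 * K)\<^sup>2 \<le>
        C\<^sup>2 * (2 * ln n) + 2 * (C * M * K)\<^sup>2 * ln n + 2 * (C * M\<^sup>2 * K)\<^sup>2 * ln n"
      using ln_ge mult_left_mono[OF ln_ge, of "2 * (C * M * K)\<^sup>2"]
        mult_left_mono[OF ln_ge, of "2 * (C * M\<^sup>2 * K)\<^sup>2"] mult_left_mono[OF ln_le, of "C\<^sup>2"]
      by simp
    also have "\<dots> = B * ln n" by (simp add: B_def algebra_simps)
    finally have "K\<^sup>2 * (C\<^sup>2 * ln (1 + real n) + 2 * (C * M * K)\<^sup>2 + 2 * (C * M\<^sup>2 * K)\<^sup>2) * (norm x)\<^sup>2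
        \<le> K\<^sup>2 * (B * ln n) * (norm x)\<^sup>2"
      by (intro mult_right_mono mult_left_mono) auto
    with cayley_orbit_decay[OF neg_frac_power_inv_linear PR C(1) PT K, of n x]
    have "(real n)\<^sup>2 * (norm (?P (R 1 (R 1 ((cayley D A ^^ n) x)))))\<^sup>2 \<le> K\<^sup>2 * (B * ln n) * (norm x)\<^sup>2"
      by linarith
    then have "(real n * norm (?P (R 1 (R 1 ((cayley D A ^^ n) x)))))\<^sup>2 \<le>
        (K * sqrt B * sqrt (ln n) * norm x)\<^sup>2"
      using B ln_ge by (simp only: power_mult_distrib) (simp add: mult_ac)
    then show ?thesis
      by (rule power2_le_imp_le) (use K B ln_ge in simp)
  qed
  \<comment> \<open>Each of the two factors \<open>?W\<close> costs \<open>1 + L\<close>.\<close>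
  define c where "c = K * sqrt B * ((1 + L) * (1 + L))"
  show thesis
  proof
    show "c \<ge> 0" using K B L(1) by (simp add: c_def)
    fix n :: nat and x assume n: "n \<ge> 3"
    have "norm (?W (?W x)) \<le> (1 + L) * ((1 + L) * norm x)"
      using W_le[of "?W x"] mult_left_mono[OF W_le[of x], of "1 + L"] L(1) by linarith
    then have "K * sqrt B * sqrt (ln n) * norm (?W (?W x)) \<le>
        K * sqrt B * sqrt (ln n) * ((1 + L) * ((1 + L) * norm x))"
      using K B n by (intro mult_left_mono) auto
    with main[OF n, of "?W (?W x)"]
    have "real n * norm ((cayley D A ^^ n) (neg_frac_power_inv D A (b + 2) x)) \<le> c * sqrt (ln n) * norm x"
      unfolding frac_power_cayley_eq[OF b] c_def by (simp add: mult_ac)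
    then show "norm ((cayley D A ^^ n) (neg_frac_power_inv D A (b + 2) x)) \<le> c * (sqrt (ln n) / n) * norm x"
      using n by (simp add: field_simps)
  qed
qed

end

text \<open>The quotient of the two rates is \<open>1 / sqrt (ln n)\<close>. Hence one estimate in
  operator norm yields both the little-o and the big-O claim.\<close>

lemma sqrt_ln_smallo:
  "(\<lambda>n::nat. sqrt (ln (real n)) / real n) \<in> o[at_top](\<lambda>n. ln (real n) / real n)"
proof (rule smalloI_tendsto)
  have "filterlim (\<lambda>n::nat. sqrt (ln (real n))) at_top sequentially"
    by (intro filterlim_compose[OF sqrt_at_top] filterlim_compose[OF ln_at_top] filterlim_real_sequentially)
  then have "((\<lambda>n::nat. inverse (sqrt (ln (real n)))) \<longlongrightarrow> 0) at_top"
    by (rule tendsto_inverse_0_at_top)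
  moreover have "\<forall>\<^sub>F n::nat in at_top. inverse (sqrt (ln (real n))) =
      (sqrt (ln (real n)) / real n) / (ln (real n) / real n)"
    using eventually_ge_at_top[of 2]
  proof eventually_elim
    case (elim n)
    then have "ln (real n) > 0" by simp
    then have "inverse (sqrt (ln (real n))) = sqrt (ln (real n)) / ln (real n)"
      by (simp add: field_simps)
    then show ?case using elim by simp
  qed
  ultimately show "((\<lambda>n::nat. (sqrt (ln (real n)) / real n) / (ln (real n) / real n)) \<longlongrightarrow> 0) at_top"
    by (rule Lim_transform_eventually)
  show "\<forall>\<^sub>F n::nat in at_top. ln (real n) / real n \<noteq> 0"
    using eventually_ge_at_top[of 2] by eventually_elim simp
qed

theorem theorem4p3:
  fixes T :: "real \<Rightarrow> 'h::chilbert_space \<Rightarrow> 'h"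
    and D :: "'h set" and A :: "'h \<Rightarrow> 'h" and \<alpha> :: real
  assumes "C0_semigroup T"
    and "uniformly_bounded_semigroup T"
    and "is_generator T D A"
    and "\<forall>\<eta>::real. \<i> * complex_of_real \<eta> \<in> resolvent_set D A"
    and "power_bounded (cayley D A)"
    and "\<alpha> > 0"
    and "(\<lambda>t::real. onorm (T t \<circ> neg_frac_power_inv D A \<alpha>)) \<in> O[at_top](\<lambda>t. 1 / t)"
  shows "(\<forall>x. (\<lambda>n::nat. norm ((cayley D A ^^ n) (neg_frac_power_inv D A (\<alpha> + 2) x)))
             \<in> o[at_top](\<lambda>n. ln (real n) / real n))
       \<and> (\<lambda>n::nat. onorm ((cayley D A ^^ n) \<circ> neg_frac_power_inv D A (\<alpha> + 2)))
             \<in> O[at_top](\<lambda>n. ln (real n) / real n)"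
proof -
  let ?P = "neg_frac_power_inv D A \<alpha>" and ?Q = "neg_frac_power_inv D A (\<alpha> + 2)" and ?V = "cayley D A"
  have T_lin: "bounded_linear (T t)" if "t \<ge> 0" for t
    using assms(1) that by (simp add: C0_semigroup_def bounded_clinear_def)
  obtain M0 where M0: "onorm (T t) \<le> M0" if "t \<ge> 0" for t
    using assms(2) by (auto simp: uniformly_bounded_semigroup_def bdd_above_def)
  define M where "M = max M0 1"
  have "norm (T t x) \<le> M * norm x" if "t \<ge> 0" for t x
  proof -
    have "onorm (T t) \<le> M" using M0[OF that] by (simp add: M_def)
    from order_trans[OF onorm[OF T_lin[OF that]] mult_right_mono[OF this norm_ge_zero]]
    show ?thesis .
  qed
  moreover have "0 \<in> resolvent_set D A" using assms(4)[rule_format, of 0] by simp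
  ultimately interpret bounded_semigroup_generator T D A M
    using assms(1,3) by unfold_locales (simp_all add: M_def)

  have V_lin: "bounded_linear ?V"
    using assms(5) by (simp add: power_bounded_def bounded_clinear_def)
  obtain K0 where K0: "onorm (?V ^^ k) \<le> K0" for k
    using assms(5) by (auto simp: power_bounded_def bdd_above_def)
  define K where "K = max K0 0"
  have K: "K \<ge> 0" "norm ((?V ^^ k) x) \<le> K * norm x" for k x
  proof -
    show "K \<ge> 0" by (simp add: K_def)
    have "onorm (?V ^^ k) \<le> K" using K0[of k] by (simp add: K_def)
    from order_trans[OF onorm[OF bounded_linear_funpow[OF V_lin]] mult_right_mono[OF this norm_ge_zero]]
    show "norm ((?V ^^ k) x) \<le> K * norm x" .
  qed

  have TP_lin: "bounded_linear (T t \<circ> ?P)" if "t \<ge> 0" for t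
    unfolding comp_def by (rule bounded_linear_compose[OF T_lin[OF that] neg_frac_power_inv_linear])
  obtain c t0 where c: "c > 0" and t0: "\<And>t. t \<ge> t0 \<Longrightarrow> norm (onorm (T t \<circ> ?P)) \<le> c * norm (1 / t)"
    using landau_o.bigE[OF assms(7)] unfolding eventually_at_top_linorder by metis
  obtain p where p: "p > 0" "\<And>x. norm (?P x) \<le> norm x * p"
    using bounded_linear.pos_bounded[OF neg_frac_power_inv_linear] by blast
  define t1 where "t1 = max t0 1"
  \<comment> \<open>The first entry handles \<open>t \<ge> t1\<close>, where
    \<open>t \<ge> 1\<close> gives \<open>c / t \<le> 2 * c / (1 + t)\<close>; the second covers the
    times before \<open>t1\<close> by mere boundedness.\<close>
  define C where "C = max (2 * c) (M * p * (1 + t1))"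
  have C: "C \<ge> 0" "norm (T t (?P x)) \<le> C / (1 + t) * norm x" if t: "t \<ge> 0" for t x
  proof -
    show "C \<ge> 0" using c by (simp add: C_def)
    show "norm (T t (?P x)) \<le> C / (1 + t) * norm x"
    proof (cases "t \<ge> t1")
      case True
      then have t': "t \<ge> t0" "t \<ge> 1" by (auto simp: t1_def)
      have "onorm (T t \<circ> ?P) \<le> c / t" using t0[OF t'(1)] t' by simp
      also have "\<dots> \<le> 2 * c / (1 + t)" using t' c by (simp add: field_simps)
      also have "\<dots> \<le> C / (1 + t)" using t by (simp add: C_def divide_right_mono)
      finally have "onorm (T t \<circ> ?P) \<le> C / (1 + t)" .
      from order_trans[OF onorm[OF TP_lin[OF t], of x] mult_right_mono[OF this norm_ge_zero]]
      show ?thesis by (simp only: comp_apply)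
    next
      case False
      have "norm (T t (?P x)) \<le> M * (norm x * p)"
        using norm_T_le[OF t, of "?P x"] mult_left_mono[OF p(2)[of x], of M] M_pos by linarith
      also have "\<dots> = M * p * norm x" by simp
      also have "\<dots> \<le> C / (1 + t) * norm x"
      proof (rule mult_right_mono)
        have "M * p * (1 + t) \<le> M * p * (1 + t1)"
          using False M_pos p(1) by (intro mult_left_mono) auto
        also have "\<dots> \<le> C" by (simp add: C_def)
        finally show "M * p \<le> C / (1 + t)" using t by (simp add: pos_le_divide_eq)
      qed simp
      finally show ?thesis .
    qed
  qed
  obtain d where d: "d \<ge> 0"
    "\<And>n x. n \<ge> 3 \<Longrightarrow> norm ((?V ^^ n) (?Q x)) \<le> d * (sqrt (ln n) / n) * norm x"
    using frac_power_cayley_decay[OF less_imp_le[OF assms(6)] C(1)[OF order_refl] C(2) K] by metis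
  have VQ_lin: "bounded_linear ((?V ^^ n) \<circ> ?Q)" for n
    unfolding comp_def
    by (rule bounded_linear_compose[OF bounded_linear_funpow[OF V_lin] neg_frac_power_inv_linear])
  have "(\<lambda>n. norm ((?V ^^ n) (?Q x))) \<in> O[at_top](\<lambda>n. sqrt (ln (real n)) / real n)" for x
  proof (rule bigoI)
    show "\<forall>\<^sub>F n in at_top. norm (norm ((?V ^^ n) (?Q x))) \<le> (d * norm x) * norm (sqrt (ln (real n)) / real n)"
      using eventually_ge_at_top[of 3] by eventually_elim (use d(2)[of _ x] in \<open>simp add: mult_ac\<close>)
  qed
  moreover have "(\<lambda>n. onorm ((?V ^^ n) \<circ> ?Q)) \<in> O[at_top](\<lambda>n. sqrt (ln (real n)) / real n)"
  proof (rule bigoI)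
    show "\<forall>\<^sub>F n in at_top. norm (onorm ((?V ^^ n) \<circ> ?Q)) \<le> d * norm (sqrt (ln (real n)) / real n)"
      using eventually_ge_at_top[of 3]
    proof eventually_elim
      case (elim n)
      \<comment> \<open>The constant \<open>d\<close> does not depend on \<open>x\<close>, so the
        pointwise bound passes to the operator norm.\<close>
      have "onorm ((?V ^^ n) \<circ> ?Q) \<le> d * (sqrt (ln n) / n)"
        by (rule onorm_bound) (use d elim in auto)
      then show ?case using onorm_pos_le[OF VQ_lin] elim by simp
    qed
  qed
  ultimately show ?thesis
    by (intro conjI allI landau_o.big_small_trans[OF _ sqrt_ln_smallo]
        landau_o.small_imp_big[OF landau_o.big_small_trans[OF _ sqrt_ln_smallo]])
qed

end
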